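(* Let $V\subseteq L^2(\mathcal{X})$ be a $(\Gamma,\sigma)$-invariant space. Then there exists a sequence of functions $\{\psi_n\}_{n\in\mathbb{N}}\subseteq L^2(\mathcal{X})$ such that $V$ can be decomposed into an orthogonal sum $$V=\bigoplus_{n=1}^\infty S_\sigma^\Gamma(\psi_n)$$ and, for each $n\in\mathbb{N}$, $E_\sigma^\Gamma(\psi_n)=\{\Pi_\sigma(\gamma)\psi_n\}_{\gamma\in\Gamma}$ is a Parseval frame for $S_\sigma^\Gamma(\psi_n)$.
   Context: Setting. $\Gamma$ is a countable discrete abelian group (written additively, identity $e$). $(\mathcal{X},\mu)$ is a $\sigma$-finite measure space with $L^2(\mathcal{X})=L^2(\mathcal{X},\mu)$ separable. $\sigma:\Gamma\times\mathcal{X}\to\mathcal{X}$ is an action: each $\sigma_\gamma:=\sigma(\gamma,\cdot)$ is measurable, $\sigma_\gamma\circ\sigma_{\gamma'}=\sigma_{\gamma+\gamma'}$, and $\sigma_e$ is the identity. The action is quasi-$\Gamma$-invariant: there is a measurable function $J_\sigma:\Gamma\times\mathcal{X}\to(0,\infty)$ (the Jacobian) with $d\mu(\sigma_\gamma(x))=J_\sigma(\gamma,x)\,d\mu(x)$, i.e. $\mu(\sigma_\gamma(E))=\int_E J_\sigma(\gamma,x)\,d\mu(x)$ for measurable $E$. The action has the tiling property: there is a measurable $C\subseteq\mathcal{X}$ with $\mu(\sigma_\gamma(C)\cap\sigma_{\gamma'}(C))=0$ for $\gamma\ne\gamma'$ and $\mu(\mathcal{X}\setminus\bigcup_{\gamma\in\Gamma}\sigma_\gamma(C))=0$.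 The associated unitary representation of $\Gamma$ on $L^2(\mathcal{X})$ is $\Pi_\sigma(\gamma)\psi(x)=J_\sigma(-\gamma,x)^{1/2}\psi(\sigma_{-\gamma}(x))$. A closed subspace $V\subseteq L^2(\mathcal{X})$ is $(\Gamma,\sigma)$-invariant if $\Pi_\sigma(\gamma)f\in V$ for all $f\in V$, $\gamma\in\Gamma$. For $\psi\in L^2(\mathcal{X})$, $S_\sigma^\Gamma(\psi)=\overline{\mathrm{span}}\{\Pi_\sigma(\gamma)\psi:\gamma\in\Gamma\}$. A finite or countable family $\{f_i\}_{i\in I}$ in a separable Hilbert space $\mathcal{H}$ is a Parseval frame for $\mathcal{H}$ if $\sum_{i\in I}|\langle f,f_i\rangle|^2=\|f\|^2$ for all $f\in\mathcal{H}$ (the functions $\psi_n$ are allowed to be zero). *)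

theory Defs
  imports "HOL-Analysis.Analysis" "HOL-Library.Function_Algebras"
begin

section \<open>The Hilbert space of square-integrable functions\<close>

text \<open>
  Elements of $L^2$ are represented by functions rather than by classes modulo equality almost
  everywhere. A subset of $L^2$ that is closed in the sense of \<open>L2_closure\<close> below is automatically
  saturated under almost-everywhere equality, so the closed subspaces considered here correspond
  exactly to the closed subspaces of the quotient.
\<close>

definition L2 :: "'x measure \<Rightarrow> ('x \<Rightarrow> complex) set" where
  "L2 M = {f \<in> borel_measurable M. integrable M (\<lambda>x. (cmod (f x))\<^sup>2)}"

definition L2_inner :: "'x measure \<Rightarrow> ('x \<Rightarrow> complex) \<Rightarrow> ('x \<Rightarrow> complex) \<Rightarrow> complex" where
  "L2_inner M f g = (LINT x|M. f x * cnj (g x))"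

definition L2_norm :: "'x measure \<Rightarrow> ('x \<Rightarrow> complex) \<Rightarrow> real" where
  "L2_norm M f = sqrt (LINT x|M. (cmod (f x))\<^sup>2)"

definition cfun_scale :: "complex \<Rightarrow> ('x \<Rightarrow> complex) \<Rightarrow> 'x \<Rightarrow> complex" where
  "cfun_scale c f = (\<lambda>x. c * f x)"

global_interpretation cfun: vector_space "cfun_scale :: complex \<Rightarrow> ('x \<Rightarrow> complex) \<Rightarrow> 'x \<Rightarrow> complex"
  by unfold_locales (auto simp: cfun_scale_def fun_eq_iff algebra_simps)

text \<open>Only meaningful for sets \<open>A\<close> contained in \<open>L2 M\<close>, as \<open>L2_norm\<close> is a junk value elsewhere.\<close>

definition L2_closure :: "'x measure \<Rightarrow> ('x \<Rightarrow> complex) set \<Rightarrow> ('x \<Rightarrow> complex) set" where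
  "L2_closure M A = {f \<in> L2 M. \<forall>\<epsilon>>0. \<exists>g\<in>A. L2_norm M (\<lambda>x. f x - g x) < \<epsilon>}"

definition L2_separable :: "'x measure \<Rightarrow> bool" where
  "L2_separable M \<longleftrightarrow> (\<exists>D. countable D \<and> D \<subseteq> L2 M \<and> L2_closure M D = L2 M)"

definition L2_closed_subspace :: "'x measure \<Rightarrow> ('x \<Rightarrow> complex) set \<Rightarrow> bool" where
  "L2_closed_subspace M V \<longleftrightarrow> V \<subseteq> L2 M \<and> cfun.subspace V \<and> L2_closure M V = V"

text \<open>The Hilbert-space (i.e. closed) direct sum of pairwise orthogonal subspaces.\<close>

definition L2_orthogonal_sum ::
  "'x measure \<Rightarrow> ('x \<Rightarrow> complex) set \<Rightarrow> (nat \<Rightarrow> ('x \<Rightarrow> complex) set) \<Rightarrow> bool" where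
  "L2_orthogonal_sum M V W \<longleftrightarrow>
     (\<forall>m n. m \<noteq> n \<longrightarrow> (\<forall>f\<in>W m. \<forall>g\<in>W n. L2_inner M f g = 0)) \<and>
     V = L2_closure M (cfun.span (\<Union>n. W n))"

definition L2_Parseval_frame ::
  "'x measure \<Rightarrow> 'i set \<Rightarrow> ('i \<Rightarrow> 'x \<Rightarrow> complex) \<Rightarrow> ('x \<Rightarrow> complex) set \<Rightarrow> bool" where
  "L2_Parseval_frame M I F H \<longleftrightarrow>
     (\<forall>i\<in>I. F i \<in> H) \<and>
     (\<forall>f\<in>H. ((\<lambda>i. (cmod (L2_inner M f (F i)))\<^sup>2) has_sum (L2_norm M f)\<^sup>2) I)"


section \<open>Quasi-invariant actions of a countable abelian group\<close>

locale quasi_invariant_action =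
  fixes M :: "'x measure"
    and \<sigma> :: "'g::{countable, ab_group_add} \<Rightarrow> 'x \<Rightarrow> 'x"
    and J :: "'g \<Rightarrow> 'x \<Rightarrow> real"
  assumes action_measurable: "\<And>\<gamma>. \<sigma> \<gamma> \<in> measurable M M"
    and action_add: "\<And>\<gamma> \<gamma>' x. x \<in> space M \<Longrightarrow> \<sigma> \<gamma> (\<sigma> \<gamma>' x) = \<sigma> (\<gamma> + \<gamma>') x"
    and action_zero: "\<And>x. x \<in> space M \<Longrightarrow> \<sigma> 0 x = x"
    and jacobian_measurable:
      "(\<lambda>(\<gamma>, x). J \<gamma> x) \<in> borel_measurable (count_space UNIV \<Otimes>\<^sub>M M)"
    and jacobian_pos: "\<And>\<gamma> x. x \<in> space M \<Longrightarrow> J \<gamma> x > 0"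
    and jacobian: "\<And>\<gamma> E. E \<in> sets M \<Longrightarrow>
      emeasure M (\<sigma> \<gamma> ` E) = (\<integral>\<^sup>+x\<in>E. ennreal (J \<gamma> x) \<partial>M)"

definition tiling_property :: "'x measure \<Rightarrow> ('g \<Rightarrow> 'x \<Rightarrow> 'x) \<Rightarrow> bool" where
  "tiling_property M \<sigma> \<longleftrightarrow>
     (\<exists>C\<in>sets M. (\<forall>\<gamma> \<gamma>'. \<gamma> \<noteq> \<gamma>' \<longrightarrow> emeasure M (\<sigma> \<gamma> ` C \<inter> \<sigma> \<gamma>' ` C) = 0) \<and>
        emeasure M (space M - (\<Union>\<gamma>. \<sigma> \<gamma> ` C)) = 0)"

definition action_rep ::
  "('g::ab_group_add \<Rightarrow> 'x \<Rightarrow> 'x) \<Rightarrow> ('g \<Rightarrow> 'x \<Rightarrow> real) \<Rightarrow> 'g \<Rightarrow> ('x \<Rightarrow> complex) \<Rightarrow> 'x \<Rightarrow> complex" where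
  "action_rep \<sigma> J \<gamma> \<psi> = (\<lambda>x. complex_of_real (sqrt (J (- \<gamma>) x)) * \<psi> (\<sigma> (- \<gamma>) x))"

definition invariant_space ::
  "'x measure \<Rightarrow> ('g::ab_group_add \<Rightarrow> 'x \<Rightarrow> 'x) \<Rightarrow> ('g \<Rightarrow> 'x \<Rightarrow> real) \<Rightarrow> ('x \<Rightarrow> complex) set \<Rightarrow> bool" where
  "invariant_space M \<sigma> J V \<longleftrightarrow>
     L2_closed_subspace M V \<and> (\<forall>f\<in>V. \<forall>\<gamma>. action_rep \<sigma> J \<gamma> f \<in> V)"

definition cyclic_space ::
  "'x measure \<Rightarrow> ('g::ab_group_add \<Rightarrow> 'x \<Rightarrow> 'x) \<Rightarrow> ('g \<Rightarrow> 'x \<Rightarrow> real) \<Rightarrow> ('x \<Rightarrow> complex) \<Rightarrow>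
     ('x \<Rightarrow> complex) set" where
  "cyclic_space M \<sigma> J \<psi> = L2_closure M (cfun.span (range (\<lambda>\<gamma>. action_rep \<sigma> J \<gamma> \<psi>)))"

end

theory Submission
  imports Defs
begin

text \<open>
  The argument needs no duality theory of the group. Cutting a dense sequence of \<open>L2 M\<close> down to the
  tile \<open>C\<close> and normalising gives functions \<open>\<phi> n\<close> whose orbits are orthogonal with norms at most \<open>1\<close>,
  hence Bessel with bound \<open>1\<close>, and jointly total.

  Let \<open>V n\<close> be the orthogonal complement in \<open>V\<close> of the first \<open>n\<close> cyclic summands, and \<open>\<eta>\<close> the projection
  of \<open>\<phi> n\<close> to \<open>V n\<close>; its orbit is again Bessel with bound \<open>1\<close>. If \<open>S\<close> is the frame operator of that orbit,
  then \<open>\<psi> n = S powr (-1/2) \<eta>\<close> has a Parseval orbit generating the same cyclic space as \<open>\<eta>\<close>. A vector of \<open>V\<close>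
  orthogonal to all these cyclic spaces is orthogonal to the orbits of all \<open>\<phi> n\<close>, hence null.

  The vector \<open>S powr (-1/2) \<eta>\<close> is the limit of the partial sums of the binomial series in \<open>A = 1 - S\<close>. As the
  coefficients are positive and the moments \<open>\<langle>A ^ k f, f\<rangle>\<close> decrease, all estimates
  reduce to inequalities between sums of moments; in particular no spectral theorem is needed.
\<close>

text \<open>\<open>S\<close> need not be bounded below, so its inverse square root is in general
  unbounded and the binomial series may diverge at an arbitrary vector. It converges at
  \<open>\<eta>\<close> because a bound valid for every f can be tested on the partial sums
  themselves (\<open>psum_nrm_le\<close>). Every bound comes from one fact about the truncation q of
  (1 - x) powr (-1/2) at degree N: the full series squares to the geometric series and its
  coefficients are positive, so q^2 lies coefficientwise between the geometric sums of degree N and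
  2 N. Multiplied by 1 - x and paired with moments, this squeezes the square sum of the coefficients
  of f against the orbit of q(A) \<open>\<eta>\<close> between |f|^2 - <A^(N+1) f, f> and |f|^2.
  Working with functions instead of classes makes the inner product only semidefinite and the group
  law of the representation only an almost everywhere identity. Hence the abstract part allows null
  vectors, and operator identities are stated after pairing with a vector.\<close>

locale semi_hilbert = vector_space scale
  for scale :: "complex \<Rightarrow> 'v::ab_group_add \<Rightarrow> 'v" +
  fixes H :: "'v set" and ip :: "'v \<Rightarrow> 'v \<Rightarrow> complex"
  assumes H_subspace: "subspace H"
    and ip_add_left: "\<And>f g h. f \<in> H \<Longrightarrow> g \<in> H \<Longrightarrow> h \<in> H \<Longrightarrow> ip (f + g) h = ip f h + ip g h"
    and ip_scale_left: "\<And>c f g. f \<in> H \<Longrightarrow> g \<in> H \<Longrightarrow> ip (scale c f) g = c * ip f g"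
    and ip_cnj: "\<And>f g. f \<in> H \<Longrightarrow> g \<in> H \<Longrightarrow> cnj (ip f g) = ip g f"
    and ip_ge_0: "\<And>f. f \<in> H \<Longrightarrow> 0 \<le> Re (ip f f)"
    and complete: "\<And>X. (\<And>n. X n \<in> H) \<Longrightarrow>
      (\<And>e. 0 < e \<Longrightarrow> \<exists>N. \<forall>m\<ge>N. \<forall>n\<ge>N. sqrt (Re (ip (X m - X n) (X m - X n))) < e) \<Longrightarrow>
      \<exists>x\<in>H. (\<lambda>n. sqrt (Re (ip (X n - x) (X n - x)))) \<longlonglongrightarrow> (0::real)"
begin

definition nrm :: "'v \<Rightarrow> real" where
  "nrm f = sqrt (Re (ip f f))"

definition cl :: "'v set \<Rightarrow> 'v set" where
  "cl A = {f \<in> H. \<forall>\<epsilon>>0. \<exists>g\<in>A. nrm (f - g) < \<epsilon>}"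

definition closed_subspace :: "'v set \<Rightarrow> bool" where
  "closed_subspace K \<longleftrightarrow> K \<subseteq> H \<and> subspace K \<and> cl K = K"

lemmas H_0 [simp] = subspace_0[OF H_subspace]
  and H_add [simp] = subspace_add[OF H_subspace]
  and H_diff [simp] = subspace_diff[OF H_subspace]
  and H_scale [simp] = subspace_scale[OF H_subspace]
  and H_sum = subspace_sum[OF H_subspace]

section \<open>Calculus of a possibly degenerate inner product: norm, closure, limits,
  projection\<close>

lemma ip_add_right: "f \<in> H \<Longrightarrow> g \<in> H \<Longrightarrow> h \<in> H \<Longrightarrow> ip f (g + h) = ip f g + ip f h"
  by (metis H_add complex_cnj_add ip_add_left ip_cnj)

lemma ip_scale_right: "f \<in> H \<Longrightarrow> g \<in> H \<Longrightarrow> ip f (scale c g) = cnj c * ip f g"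
  by (metis H_scale complex_cnj_mult ip_cnj ip_scale_left)

lemma ip_zero_left [simp]: "f \<in> H \<Longrightarrow> ip 0 f = 0"
  using ip_scale_left[of 0 f 0] by simp

lemma ip_zero_right [simp]: "f \<in> H \<Longrightarrow> ip f 0 = 0"
  using ip_scale_right[of f 0 0] by simp

lemma ip_diff_left: "f \<in> H \<Longrightarrow> g \<in> H \<Longrightarrow> h \<in> H \<Longrightarrow> ip (f - g) h = ip f h - ip g h"
  using ip_add_left[of "f - g" g h] by simp

lemma ip_diff_right: "f \<in> H \<Longrightarrow> g \<in> H \<Longrightarrow> h \<in> H \<Longrightarrow> ip f (g - h) = ip f g - ip f h"
  using ip_add_right[of f "g - h" h] by simp

lemma ip_sum_left:
  assumes "\<And>i. i \<in> I \<Longrightarrow> F i \<in> H" "g \<in> H"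
  shows "ip (\<Sum>i\<in>I. F i) g = (\<Sum>i\<in>I. ip (F i) g)"
  using assms by (induction I rule: infinite_finite_induct) (auto simp: ip_add_left H_sum)

lemma ip_sum_right:
  assumes "\<And>i. i \<in> I \<Longrightarrow> F i \<in> H" "g \<in> H"
  shows "ip g (\<Sum>i\<in>I. F i) = (\<Sum>i\<in>I. ip g (F i))"
  using assms by (induction I rule: infinite_finite_induct) (auto simp: ip_add_right H_sum)

lemma nrm_ge_0 [simp]: "f \<in> H \<Longrightarrow> 0 \<le> nrm f"
  by (simp add: nrm_def ip_ge_0)

lemma nrm_zero [simp]: "nrm 0 = 0"
  by (simp add: nrm_def)

lemma nrm_sq: "f \<in> H \<Longrightarrow> (nrm f)\<^sup>2 = Re (ip f f)"
  by (simp add: nrm_def ip_ge_0)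

lemma ip_self: "f \<in> H \<Longrightarrow> ip f f = complex_of_real ((nrm f)\<^sup>2)"
  using ip_cnj[of f f] by (simp add: nrm_sq complex_eq_iff)

lemma ip_cmod_commute: "f \<in> H \<Longrightarrow> g \<in> H \<Longrightarrow> cmod (ip f g) = cmod (ip g f)"
  by (metis complex_mod_cnj ip_cnj)

lemma ip_mult_swap: "f \<in> H \<Longrightarrow> g \<in> H \<Longrightarrow> ip f g * ip g f = complex_of_real ((cmod (ip f g))\<^sup>2)"
  by (metis complex_norm_square ip_cnj of_real_power)

lemma nrm_scale: "f \<in> H \<Longrightarrow> nrm (scale c f) = cmod c * nrm f"
proof -
  assume f: "f \<in> H"
  have "ip (scale c f) (scale c f) = complex_of_real ((cmod c)\<^sup>2) * ip f f"
    using f by (simp add: ip_scale_left ip_scale_right complex_norm_square flip: of_real_power)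
  then have "Re (ip (scale c f) (scale c f)) = (cmod c)\<^sup>2 * Re (ip f f)"
    by simp
  then show ?thesis
    by (simp add: nrm_def real_sqrt_mult)
qed

lemma nrm_diff_sq:
  assumes "f \<in> H" "g \<in> H"
  shows "(nrm (f - g))\<^sup>2 = (nrm f)\<^sup>2 + (nrm g)\<^sup>2 - 2 * Re (ip f g)"
proof -
  have "Re (ip g f) = Re (ip f g)"
    using arg_cong[OF ip_cnj[OF assms], of Re] by simp
  then show ?thesis
    using assms by (simp add: nrm_sq ip_diff_left ip_diff_right)
qed

lemma nrm_add_sq:
  assumes "f \<in> H" "g \<in> H"
  shows "(nrm (f + g))\<^sup>2 = (nrm f)\<^sup>2 + (nrm g)\<^sup>2 + 2 * Re (ip f g)"
proof -
  have "Re (ip g f) = Re (ip f g)"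
    using arg_cong[OF ip_cnj[OF assms], of Re] by simp
  then show ?thesis
    using assms by (simp add: nrm_sq ip_add_left ip_add_right)
qed

lemma nrm_diff_scale_sq:
  fixes t :: real
  assumes "f \<in> H" "g \<in> H"
  shows "(nrm (f - scale (of_real t * ip f g) g))\<^sup>2
    = (nrm f)\<^sup>2 - 2 * t * (cmod (ip f g))\<^sup>2 + t\<^sup>2 * (cmod (ip f g))\<^sup>2 * (nrm g)\<^sup>2"
proof -
  have "Re (ip f (scale (of_real t * ip f g) g)) = t * (cmod (ip f g))\<^sup>2"
    using assms by (simp add: ip_scale_right mult.assoc cmod_power2 flip: power2_eq_square)
  then show ?thesis
    using assms by (simp add: nrm_diff_sq nrm_scale norm_mult power_mult_distrib)
qed

lemma Cauchy_Schwarz: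
  assumes f: "f \<in> H" and g: "g \<in> H"
  shows "cmod (ip f g) \<le> nrm f * nrm g"
proof (cases "ip f g = 0")
  case True
  then show ?thesis using assms by simp
next
  case False
  define b where "b = (cmod (ip f g))\<^sup>2"
  have b: "b > 0" using False by (simp add: b_def)
  have *: "0 \<le> (nrm f)\<^sup>2 - 2 * t * b + t\<^sup>2 * b * (nrm g)\<^sup>2" for t
    using nrm_diff_scale_sq[OF assms, of t] unfolding b_def by (metis zero_le_power2)
  have "b \<le> (nrm f)\<^sup>2 * (nrm g)\<^sup>2"
  proof (cases "nrm g = 0")
    case True
    \<comment> \<open>For null g the quadratic in t is affine; this t gives it the value -1, which
      contradicts nonnegativity.\<close>
    with *[of "((nrm f)\<^sup>2 + 1) / (2 * b)"] b show ?thesis by simp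
  next
    case False
    then have d: "(nrm g)\<^sup>2 > 0" by simp
    have "0 \<le> (nrm f)\<^sup>2 - 2 * (1 / (nrm g)\<^sup>2) * b + (1 / (nrm g)\<^sup>2)\<^sup>2 * b * (nrm g)\<^sup>2"
      by (rule *)
    also have "\<dots> = (nrm f)\<^sup>2 - b / (nrm g)\<^sup>2"
      using d by (simp add: power2_eq_square field_simps)
    finally show ?thesis using d by (simp add: field_simps)
  qed
  then have "(cmod (ip f g))\<^sup>2 \<le> (nrm f * nrm g)\<^sup>2"
    by (simp add: b_def power_mult_distrib)
  then show ?thesis
    by (rule power2_le_imp_le) (use assms in simp)
qed

lemma nrm_triangle:
  assumes "f \<in> H" "g \<in> H"
  shows "nrm (f + g) \<le> nrm f + nrm g"
proof (rule power2_le_imp_le)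
  have "Re (ip f g) \<le> nrm f * nrm g"
    using Cauchy_Schwarz[OF assms] complex_Re_le_cmod order_trans by blast
  then show "(nrm (f + g))\<^sup>2 \<le> (nrm f + nrm g)\<^sup>2"
    using assms by (simp add: nrm_add_sq power2_sum)
qed (use assms in simp)

lemma nrm_minus_commute: "f \<in> H \<Longrightarrow> g \<in> H \<Longrightarrow> nrm (f - g) = nrm (g - f)"
  using nrm_scale[of "g - f" "-1"] by (simp add: scale_minus_left scale_one)

lemma nrm_triangle_diff:
  assumes "f \<in> H" "g \<in> H" "h \<in> H"
  shows "nrm (f - h) \<le> nrm (f - g) + nrm (g - h)"
  using nrm_triangle[of "f - g" "g - h"] assms by simp

text \<open>Turns an identity known only after pairing into equality up to a null vector; together
  with \<open>closed_subspace_null\<close> it replaces equality of vectors in membership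
  arguments.\<close>

lemma nrm_le_of_ip:
  assumes "f \<in> H" "\<And>g. g \<in> H \<Longrightarrow> ip f g = 0"
  shows "nrm f = 0"
  using assms by (simp add: nrm_def)

lemma cl_subset_H: "cl A \<subseteq> H"
  by (auto simp: cl_def)

lemma cl_superset: "A \<subseteq> H \<Longrightarrow> A \<subseteq> cl A"
  by (force simp: cl_def)

lemma cl_mono: "A \<subseteq> B \<Longrightarrow> cl A \<subseteq> cl B"
  by (force simp: cl_def)

lemma cl_cl:
  assumes "A \<subseteq> H"
  shows "cl (cl A) = cl A"
proof
  show "cl (cl A) \<subseteq> cl A"
  proof
    fix f assume f: "f \<in> cl (cl A)"
    have "\<exists>g\<in>A. nrm (f - g) < e" if e: "e > 0" for e
    proof -
      obtain h where h: "h \<in> cl A" "nrm (f - h) < e/2"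
        using f e unfolding cl_def[of "cl A"] by (auto dest!: spec[of _ "e/2"])
      obtain g where g: "g \<in> A" "nrm (h - g) < e/2"
        using h e unfolding cl_def by (auto dest!: spec[of _ "e/2"])
      have "nrm (f - g) \<le> nrm (f - h) + nrm (h - g)"
        using f g h assms cl_subset_H by (intro nrm_triangle_diff) auto
      then show ?thesis using g h by force
    qed
    then show "f \<in> cl A" using f by (auto simp: cl_def)
  qed
qed (rule cl_superset[OF cl_subset_H])

lemma subspace_cl:
  assumes K: "subspace K" "K \<subseteq> H"
  shows "subspace (cl K)"
proof (rule subspaceI)
  show "0 \<in> cl K" using subsetD[OF cl_superset[OF K(2)] subspace_0[OF K(1)]] .
next
  fix f g assume fg: "f \<in> cl K" "g \<in> cl K"
  have "\<exists>h\<in>K. nrm (f + g - h) < e" if e: "e > 0" for e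
  proof -
    obtain f' where f': "f' \<in> K" "nrm (f - f') < e/2"
      using fg e unfolding cl_def by (auto dest!: spec[of _ "e/2"])
    obtain g' where g': "g' \<in> K" "nrm (g - g') < e/2"
      using fg e unfolding cl_def by (auto dest!: spec[of _ "e/2"])
    have "f \<in> H" "g \<in> H" "f' \<in> H" "g' \<in> H"
      using fg f' g' K cl_subset_H by blast+
    then have "nrm ((f - f') + (g - g')) \<le> nrm (f - f') + nrm (g - g')"
      by (intro nrm_triangle) auto
    moreover have "(f - f') + (g - g') = f + g - (f' + g')" by simp
    ultimately have "nrm (f + g - (f' + g')) < e" using f' g' by simp
    then show ?thesis using subspace_add[OF K(1) f'(1) g'(1)] by blast
  qed
  then show "f + g \<in> cl K" using fg by (auto simp: cl_def)
next
  fix c f assume f: "f \<in> cl K"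
  have "\<exists>h\<in>K. nrm (scale c f - h) < e" if e: "e > 0" for e
  proof -
    obtain f' where f': "f' \<in> K" "nrm (f - f') < e / (cmod c + 1)"
      using f e unfolding cl_def
      by (auto dest!: spec[of _ "e / (cmod c + 1)"] simp: add_nonneg_pos)
    have H: "f \<in> H" "f' \<in> H" using f f' K cl_subset_H by auto
    have "nrm (scale c f - scale c f') = cmod c * nrm (f - f')"
      using H by (simp add: nrm_scale flip: scale_right_diff_distrib)
    also have "\<dots> \<le> (cmod c + 1) * nrm (f - f')"
      using H by (intro mult_right_mono) auto
    also have "\<dots> < e" using f'(2)
      by (simp add: pos_less_divide_eq add_nonneg_pos mult.commute)
    finally show ?thesis using subspace_scale[OF K(1) f'(1)] by blast
  qed
  then show "scale c f \<in> cl K" using f by (auto simp: cl_def)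
qed

lemma span_subset_H: "A \<subseteq> H \<Longrightarrow> span A \<subseteq> H"
  using H_subspace span_minimal by blast

lemma closed_subspace_cl_span: "A \<subseteq> H \<Longrightarrow> closed_subspace (cl (span A))"
  unfolding closed_subspace_def
  by (simp add: cl_cl cl_subset_H span_subset_H subspace_cl)

lemma cl_span_superset: "A \<subseteq> H \<Longrightarrow> A \<subseteq> cl (span A)"
  by (rule order_trans[OF span_superset cl_superset[OF span_subset_H]])

lemma cl_span_minimal: "A \<subseteq> K \<Longrightarrow> closed_subspace K \<Longrightarrow> cl (span A) \<subseteq> K"
  unfolding closed_subspace_def by (metis cl_mono span_minimal)

lemma closed_subspace_limit:
  assumes K: "closed_subspace K" and X: "\<And>n. X n \<in> K" and x: "x \<in> H"
    and lim: "(\<lambda>n. nrm (X n - x)) \<longlonglongrightarrow> 0"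
  shows "x \<in> K"
proof -
  have "\<exists>g\<in>K. nrm (x - g) < e" if "e > 0" for e
  proof -
    have "\<forall>\<^sub>F n in sequentially. nrm (X n - x) < e"
      using order_tendstoD(2)[OF lim that] .
    then obtain n where "nrm (X n - x) < e" by (auto simp: eventually_sequentially)
    moreover have "X n \<in> H" using X K by (auto simp: closed_subspace_def)
    ultimately show ?thesis using X nrm_minus_commute x by metis
  qed
  then have "x \<in> cl K" using x by (auto simp: cl_def)
  then show ?thesis using K by (simp add: closed_subspace_def)
qed

text \<open>The constant sequence at f converges to g, so closed sets cannot separate vectors at
  distance zero.\<close>

lemma closed_subspace_null:
  assumes K: "closed_subspace K" and "f \<in> K" "g \<in> H" "nrm (f - g) = 0"
  shows "g \<in> K"
  using closed_subspace_limit[OF K, of "\<lambda>_. f" g] assms by simp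

lemma tendsto_ip_left:
  assumes X: "\<And>n. X n \<in> H" "x \<in> H" "g \<in> H" and lim: "(\<lambda>n. nrm (X n - x)) \<longlonglongrightarrow> 0"
  shows "(\<lambda>n. ip (X n) g) \<longlonglongrightarrow> ip x g"
proof -
  have "(\<lambda>n. ip (X n) g - ip x g) \<longlonglongrightarrow> 0"
  proof (rule Lim_null_comparison)
    show "\<forall>\<^sub>F n in sequentially. cmod (ip (X n) g - ip x g) \<le> nrm (X n - x) * nrm g"
      using X Cauchy_Schwarz[of "X _ - x" g] by (simp add: ip_diff_left)
    show "(\<lambda>n. nrm (X n - x) * nrm g) \<longlonglongrightarrow> 0"
      using tendsto_mult_left_zero[OF lim] .
  qed
  then show ?thesis using LIM_zero_iff by blast
qed

lemma tendsto_ip_right: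
  assumes X: "\<And>n. X n \<in> H" "x \<in> H" "g \<in> H" and lim: "(\<lambda>n. nrm (X n - x)) \<longlonglongrightarrow> 0"
  shows "(\<lambda>n. ip g (X n)) \<longlonglongrightarrow> ip g x"
  using tendsto_cnj[OF tendsto_ip_left[OF assms]] assms(1-3) by (simp add: ip_cnj)

lemma tendsto_nrm:
  assumes X: "\<And>n. X n \<in> H" "x \<in> H" and lim: "(\<lambda>n. nrm (X n - x)) \<longlonglongrightarrow> 0"
  shows "(\<lambda>n. nrm (X n)) \<longlonglongrightarrow> nrm x"
proof -
  have "(\<lambda>n. nrm (X n) - nrm x) \<longlonglongrightarrow> 0"
  proof (rule Lim_null_comparison[OF always_eventually lim], intro allI)
    fix n
    show "norm (nrm (X n) - nrm x) \<le> nrm (X n - x)"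
      using nrm_triangle[of "X n - x" x] nrm_triangle[of "x - X n" "X n"] X
      by (simp add: nrm_minus_commute[of x] abs_le_iff)
  qed
  then show ?thesis using LIM_zero_iff by blast
qed

lemma complete_nrm:
  assumes "\<And>n. X n \<in> H" "\<And>e. 0 < e \<Longrightarrow> \<exists>N. \<forall>m\<ge>N. \<forall>n\<ge>N. nrm (X m - X n) < e"
  obtains x where "x \<in> H" "(\<lambda>n. nrm (X n - x)) \<longlonglongrightarrow> 0"
  using complete[of X] assms unfolding nrm_def by blast

text \<open>The hypotheses make b increasing and bounded, hence Cauchy, and b controls the
  increments of X. Applied to Bessel sums in \<open>bessel_synthesis\<close> and to the squared
  norms of the binomial partial sums in \<open>psum_limit\<close>.\<close>

lemma complete_monotone:
  fixes b :: "nat \<Rightarrow> real"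
  assumes X: "\<And>n. X n \<in> H"
    and bd: "\<And>m n. n \<le> m \<Longrightarrow> (nrm (X m - X n))\<^sup>2 \<le> b m - b n" and b: "\<And>n. b n \<le> B"
  obtains x where "x \<in> H" "(\<lambda>n. nrm (X n - x)) \<longlonglongrightarrow> 0"
proof -
  have "incseq b"
    using bd by (intro incseq_SucI) (metis diff_ge_0_iff_ge le_SucI order_refl order_trans zero_le_power2)
  then obtain L where "b \<longlonglongrightarrow> L" using incseq_convergent b by blast
  then have "Cauchy b" using LIMSEQ_imp_Cauchy by blast
  have "\<exists>N. \<forall>m\<ge>N. \<forall>n\<ge>N. nrm (X m - X n) < e" if e: "e > 0" for e
  proof -
    obtain N where N: "\<And>m n. m \<ge> N \<Longrightarrow> n \<ge> N \<Longrightarrow> \<bar>b m - b n\<bar> < e\<^sup>2"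
      using CauchyD[OF \<open>Cauchy b\<close>, of "e\<^sup>2"] e by auto
    have *: "nrm (X m - X n) < e" if "n \<ge> N" "m \<ge> n" for m n
    proof -
      have "(nrm (X m - X n))\<^sup>2 < e\<^sup>2" using bd[of n m] N[of m n] that by simp
      then show ?thesis using e by (simp add: power2_less_imp_less)
    qed
    have "nrm (X m - X n) < e" if "m \<ge> N" "n \<ge> N" for m n
      using *[of n m] *[of m n] that X nrm_minus_commute[of "X m" "X n"] by (cases "n \<le> m") auto
    then show ?thesis by blast
  qed
  then show ?thesis using complete_nrm[of X] X that by blast
qed

lemma projection:
  assumes K: "closed_subspace K" and f: "f \<in> H"
  obtains p where "p \<in> K" "\<And>k. k \<in> K \<Longrightarrow> ip (f - p) k = 0"
proof -
  have KH: "k \<in> H" if "k \<in> K" for k using K that by (auto simp: closed_subspace_def)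
  have sub: "subspace K" using K by (simp add: closed_subspace_def)
  define d where "d = (INF k\<in>K. nrm (f - k))"
  have bdd: "bdd_below ((\<lambda>k. nrm (f - k)) ` K)"
    using f KH by (intro bdd_belowI2[of _ 0]) auto
  have d: "d \<le> nrm (f - k)" if "k \<in> K" for k
    unfolding d_def using bdd that by (rule cINF_lower)
  have ne: "K \<noteq> {}" using subspace_0[OF sub] by blast
  have d0: "0 \<le> d" unfolding d_def using f KH ne by (intro cINF_greatest) auto
  have "\<exists>k\<in>K. nrm (f - k) < d + 1 / Suc n" for n
    using cInf_lessD[of "(\<lambda>k. nrm (f - k)) ` K" "d + 1 / Suc n"] ne by (auto simp: d_def)
  then obtain X where X: "\<And>n. X n \<in> K" "\<And>n. nrm (f - X n) < d + 1 / Suc n" by metis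
  note XH = KH[OF X(1)]
  \<comment> \<open>Parallelogram law: the midpoint of X m and X n stays in K, so its distance to f
    is at least d, and this forces a minimizing sequence to be Cauchy.\<close>
  have pl: "(nrm (X m - X n))\<^sup>2 \<le> 2 * (d + 1 / Suc m)\<^sup>2 + 2 * (d + 1 / Suc n)\<^sup>2 - 4 * d\<^sup>2" for m n
  proof -
    let ?u = "f - X m" and ?v = "f - X n"
    let ?k = "scale (1/2) (X m + X n)"
    have k: "?k \<in> K" using X sub by (simp add: subspace_add subspace_scale)
    have "scale 2 (f - ?k) = ?u + ?v"
      using scale_left_distrib[of 1 1 f] by (simp add: scale_right_diff_distrib)
    then have "(nrm (?u + ?v))\<^sup>2 = 4 * (nrm (f - ?k))\<^sup>2"
      using nrm_scale[of "f - ?k" 2] f KH[OF k] by (simp add: power_mult_distrib)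
    moreover have "4 * d\<^sup>2 \<le> 4 * (nrm (f - ?k))\<^sup>2"
      using d[OF k] d0 by (simp add: power_mono)
    moreover have "(nrm (?u - ?v))\<^sup>2 + (nrm (?u + ?v))\<^sup>2 = 2 * (nrm ?u)\<^sup>2 + 2 * (nrm ?v)\<^sup>2"
      using nrm_diff_sq[of ?u ?v] nrm_add_sq[of ?u ?v] f XH by simp
    moreover have "(nrm (?u - ?v))\<^sup>2 = (nrm (X m - X n))\<^sup>2"
      using nrm_minus_commute[of "X m" "X n"] XH by simp
    moreover have "(nrm ?u)\<^sup>2 \<le> (d + 1 / Suc m)\<^sup>2" "(nrm ?v)\<^sup>2 \<le> (d + 1 / Suc n)\<^sup>2"
      using X(2)[of m] X(2)[of n] f XH by (auto intro!: power_mono)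
    ultimately show ?thesis by linarith
  qed
  have "\<exists>N. \<forall>m\<ge>N. \<forall>n\<ge>N. nrm (X m - X n) < e" if e: "e > 0" for e
  proof -
    have "(\<lambda>n. (d + 1 / Suc n)\<^sup>2) \<longlonglongrightarrow> (d + 0)\<^sup>2"
      by (intro tendsto_intros LIMSEQ_Suc[OF lim_1_over_n])
    then have "\<forall>\<^sub>F n in sequentially. (d + 1 / Suc n)\<^sup>2 < d\<^sup>2 + e\<^sup>2 / 4"
      using e by (intro order_tendstoD(2)) auto
    then obtain N where N: "\<And>n. n \<ge> N \<Longrightarrow> (d + 1 / Suc n)\<^sup>2 < d\<^sup>2 + e\<^sup>2 / 4"
      by (auto simp: eventually_sequentially)
    have "(nrm (X m - X n))\<^sup>2 < e\<^sup>2" if "m \<ge> N" "n \<ge> N" for m n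
      using pl[of m n] N[OF that(1)] N[OF that(2)] by linarith
    then have "nrm (X m - X n) < e" if "m \<ge> N" "n \<ge> N" for m n
      using that e power2_less_imp_less[of "nrm (X m - X n)" e] by auto
    then show ?thesis by blast
  qed
  then obtain p where p: "p \<in> H" "(\<lambda>n. nrm (X n - p)) \<longlonglongrightarrow> 0"
    using complete_nrm[of X] XH by blast
  have pK: "p \<in> K" using closed_subspace_limit[OF K X(1) p] .
  have "nrm (f - p) \<le> d"
  proof (rule LIMSEQ_le[of "\<lambda>_. nrm (f - p)" _ "\<lambda>n. (d + 1 / Suc n) + nrm (X n - p)"])
    show "(\<lambda>n. d + 1 / Suc n + nrm (X n - p)) \<longlonglongrightarrow> d"
      using tendsto_add[OF tendsto_add[OF tendsto_const LIMSEQ_Suc[OF lim_1_over_n]] p(2), of d] by simp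
    show "\<exists>N. \<forall>n\<ge>N. nrm (f - p) \<le> (d + 1 / Suc n) + nrm (X n - p)"
    proof (intro exI allI impI)
      fix n
      show "nrm (f - p) \<le> (d + 1 / Suc n) + nrm (X n - p)"
        using nrm_triangle_diff[OF f XH[of n] p(1)] X(2)[of n] by linarith
    qed
  qed simp
  then have pd: "nrm (f - p) = d" using d[OF pK] by simp
  have "ip (f - p) k = 0" if k: "k \<in> K" for k
  proof (rule ccontr)
    assume c: "ip (f - p) k \<noteq> 0"
    define b where "b = (cmod (ip (f - p) k))\<^sup>2"
    have b: "b > 0" using c by (simp add: b_def)
    \<comment> \<open>Moving p by a small multiple of k would beat the minimal distance. The summand
      1 keeps t meaningful for null k and gives t |k|^2 < 1, which makes the decrease
      strict.\<close>
    define t where "t = 1 / ((nrm k)\<^sup>2 + 1)"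
    have "0 < (nrm k)\<^sup>2 + 1" by (simp add: add_nonneg_pos)
    then have t: "t > 0" "t * (nrm k)\<^sup>2 < 1" by (auto simp: t_def)
    let ?s = "scale (of_real t * ip (f - p) k) k"
    have "p + ?s \<in> K" using pK k sub by (simp add: subspace_add subspace_scale)
    then have "d \<le> nrm (f - p - ?s)" using d by (simp add: diff_diff_eq)
    then have "d\<^sup>2 \<le> (nrm (f - p - ?s))\<^sup>2" using d0 by (simp add: power_mono)
    also have "\<dots> = d\<^sup>2 - 2 * t * b + t\<^sup>2 * b * (nrm k)\<^sup>2"
      using nrm_diff_scale_sq[of "f - p" k t] f p KH[OF k] by (simp add: pd b_def)
    also have "\<dots> = d\<^sup>2 - t * b * (2 - t * (nrm k)\<^sup>2)" by (simp add: power2_eq_square algebra_simps)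
    finally have "t * b * (2 - t * (nrm k)\<^sup>2) \<le> 0" by simp
    moreover have "t * b * (2 - t * (nrm k)\<^sup>2) > 0" using t b by (intro mult_pos_pos) auto
    ultimately show False by simp
  qed
  then show ?thesis using that pK by blast
qed

end

section \<open>Bessel families\<close>

context semi_hilbert
begin

text \<open>The bound is fixed to 1 so that the frame operator satisfies S \<le> 1 and 1 - S is
  positive. Quantifying over finite sets avoids any appeal to summability.\<close>

definition bessel :: "('i \<Rightarrow> 'v) \<Rightarrow> bool" where
  "bessel e \<longleftrightarrow> range e \<subseteq> H \<and>
     (\<forall>f\<in>H. \<forall>F. finite F \<longrightarrow> (\<Sum>i\<in>F. (cmod (ip f (e i)))\<^sup>2) \<le> (nrm f)\<^sup>2)"

text \<open>Expand |f - s|^2 \<ge> 0 for s the sum of the terms <f, e i> e i. Vectors of norm at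
  most 1, null ones included, are enough, because then |s|^2 is at most <f, s>, the Bessel
  sum.\<close>

lemma bessel_orthogonal:
  assumes e: "range e \<subseteq> H" and orth: "\<And>i j. i \<noteq> j \<Longrightarrow> ip (e i) (e j) = 0"
    and n1: "\<And>i. nrm (e i) \<le> 1"
  shows "bessel e"
  unfolding bessel_def
proof (intro conjI ballI allI impI e)
  fix f and F :: "'a set"
  assume f: "f \<in> H" and F: "finite F"
  have eH: "e i \<in> H" for i using e by auto
  define s where "s = (\<Sum>i\<in>F. scale (ip f (e i)) (e i))"
  have sH: "s \<in> H" unfolding s_def using eH by (intro H_sum) auto
  let ?B = "\<Sum>i\<in>F. (cmod (ip f (e i)))\<^sup>2"
  have fs: "ip f s = complex_of_real ?B"
    unfolding s_def using f eH
    by (subst ip_sum_right) (auto simp: ip_scale_right complex_norm_square mult.commute simp del: of_real_power)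
  have es: "ip (e i) s = cnj (ip f (e i)) * complex_of_real ((nrm (e i))\<^sup>2)" if "i \<in> F" for i
  proof -
    have "ip (e i) s = (\<Sum>j\<in>F. cnj (ip f (e j)) * ip (e i) (e j))"
      unfolding s_def using eH by (subst ip_sum_right) (auto simp: ip_scale_right)
    also have "\<dots> = (\<Sum>j\<in>F. if j = i then cnj (ip f (e i)) * ip (e i) (e i) else 0)"
      using orth by (intro sum.cong) auto
    finally show ?thesis using that F eH by (simp add: ip_self)
  qed
  have "ip s s = (\<Sum>i\<in>F. ip f (e i) * ip (e i) s)"
    using sH eH by (subst (1) s_def, subst ip_sum_left) (auto simp: ip_scale_left)
  also have "\<dots> = (\<Sum>i\<in>F. complex_of_real ((cmod (ip f (e i)))\<^sup>2 * (nrm (e i))\<^sup>2))"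
    by (intro sum.cong refl) (simp only: es mult.assoc[symmetric] of_real_mult complex_norm_square)
  finally have "(nrm s)\<^sup>2 = (\<Sum>i\<in>F. (cmod (ip f (e i)))\<^sup>2 * (nrm (e i))\<^sup>2)"
    using sH by (simp add: nrm_sq flip: of_real_mult of_real_power)
  also have "\<dots> \<le> (\<Sum>i\<in>F. (cmod (ip f (e i)))\<^sup>2 * 1)"
    using n1 eH by (intro sum_mono mult_left_mono) (auto simp: power_le_one)
  finally have "(nrm s)\<^sup>2 \<le> ?B" by simp
  moreover have "0 \<le> (nrm f)\<^sup>2 + (nrm s)\<^sup>2 - 2 * ?B"
    using nrm_diff_sq[OF f sH] fs by (metis Re_complex_of_real zero_le_power2)
  ultimately show "?B \<le> (nrm f)\<^sup>2" by linarith
qed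

text \<open>Synthesis is adjoint to the analysis map, so it has the same bound: pair the sum t with
  itself, apply Cauchy-Schwarz to the coefficients, and cancel one factor |t|.\<close>

lemma bessel_synthesis_bound:
  assumes e: "bessel e" and F: "finite F"
  shows "(nrm (\<Sum>i\<in>F. scale (c i) (e i)))\<^sup>2 \<le> (\<Sum>i\<in>F. (cmod (c i))\<^sup>2)"
proof -
  have eH: "e i \<in> H" for i using e by (auto simp: bessel_def)
  define t where "t = (\<Sum>i\<in>F. scale (c i) (e i))"
  have tH: "t \<in> H" unfolding t_def using eH by (intro H_sum) auto
  have "ip t t = (\<Sum>i\<in>F. c i * ip (e i) t)"
    using tH eH by (subst (1) t_def, subst ip_sum_left) (auto simp: ip_scale_left)
  then have "cmod (ip t t) \<le> (\<Sum>i\<in>F. \<bar>cmod (c i)\<bar> * \<bar>cmod (ip t (e i))\<bar>)"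
    using ip_cmod_commute[OF tH eH] by (auto intro!: sum_norm_le simp: norm_mult)
  also have "\<dots> \<le> L2_set (\<lambda>i. cmod (c i)) F * L2_set (\<lambda>i. cmod (ip t (e i))) F"
    by (rule L2_set_mult_ineq)
  also have "\<dots> \<le> L2_set (\<lambda>i. cmod (c i)) F * nrm t"
  proof (intro mult_left_mono)
    have "(\<Sum>i\<in>F. (cmod (ip t (e i)))\<^sup>2) \<le> (nrm t)\<^sup>2"
      using e tH F by (auto simp: bessel_def)
    then show "L2_set (\<lambda>i. cmod (ip t (e i))) F \<le> nrm t"
      unfolding L2_set_def using tH by (simp add: real_le_lsqrt)
  qed auto
  finally have "nrm t * nrm t \<le> L2_set (\<lambda>i. cmod (c i)) F * nrm t"
    using tH by (simp add: ip_self power2_eq_square norm_mult)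
  then have "nrm t \<le> L2_set (\<lambda>i. cmod (c i)) F"
    using nrm_ge_0[OF tH] L2_set_nonneg[of "\<lambda>i. cmod (c i)" F]
    by (cases "nrm t = 0") (auto simp: mult_le_cancel_right)
  then have "(nrm t)\<^sup>2 \<le> (L2_set (\<lambda>i. cmod (c i)) F)\<^sup>2"
    using tH by (intro power_mono) auto
  then show ?thesis
    by (simp add: t_def L2_set_def sum_nonneg)
qed

lemma bessel_summable:
  assumes e: "bessel e" and f: "f \<in> H"
  shows "(\<lambda>i. (cmod (ip f (e i)))\<^sup>2) summable_on UNIV"
  using assms unfolding bessel_def
  by (intro nonneg_bdd_above_summable_on bdd_aboveI2[where M = "(nrm f)\<^sup>2"]) auto

text \<open>Existence of the value s = S f. The last conclusion encodes S^2 \<le> S, inherited in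
  the limit from the synthesis bound for the partial sums; it is what later gives A^2 \<le>
  A.\<close>

lemma bessel_synthesis:
  fixes e :: "'i::countable \<Rightarrow> 'v"
  assumes e: "bessel e" and f: "f \<in> H"
  obtains s where "s \<in> cl (span (range e))"
    and "\<And>g. g \<in> H \<Longrightarrow> ((\<lambda>i. ip f (e i) * ip (e i) g) has_sum ip s g) UNIV"
    and "(nrm s)\<^sup>2 \<le> Re (ip s f)"
proof -
  have eH: "e i \<in> H" for i using e by (auto simp: bessel_def)
  have range: "range e \<subseteq> H" using eH by blast
  \<comment> \<open>An exhaustion of the index type through \<open>to_nat\<close>, so that unordered
    sums can be evaluated as limits of sequences.\<close>
  define F where "F n = {i::'i. to_nat i < n}" for n
  have F: "finite (F n)" for n
    using finite_vimageI[of "{..<n}" "to_nat :: 'i \<Rightarrow> nat"] by (simp add: F_def vimage_def)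
  have F_mono: "F n \<subseteq> F m" if "n \<le> m" for n m using that by (auto simp: F_def)
  have F_lim: "filterlim F (finite_subsets_at_top UNIV) sequentially"
    unfolding filterlim_finite_subsets_at_top
  proof (intro allI impI)
    fix X :: "'i set" assume "finite X \<and> X \<subseteq> UNIV"
    then have "finite (to_nat ` X)" by simp
    then obtain N where "\<forall>k\<in>to_nat ` X. k < N" using finite_nat_set_iff_bounded by blast
    then show "\<forall>\<^sub>F n in sequentially. finite (F n) \<and> X \<subseteq> F n \<and> F n \<subseteq> UNIV"
      using F by (auto simp: eventually_sequentially F_def intro!: exI[of _ N])
  qed
  define X where "X n = (\<Sum>i\<in>F n. scale (ip f (e i)) (e i))" for n
  define b where "b n = (\<Sum>i\<in>F n. (cmod (ip f (e i)))\<^sup>2)" for n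
  have XH: "X n \<in> H" for n unfolding X_def using eH by (intro H_sum) auto
  have Xb: "(nrm (X n))\<^sup>2 \<le> b n" for n
    unfolding X_def b_def using bessel_synthesis_bound[OF e F] .
  have "(nrm (X m - X n))\<^sup>2 \<le> b m - b n" if "n \<le> m" for m n
  proof -
    have "X m - X n = (\<Sum>i\<in>F m - F n. scale (ip f (e i)) (e i))"
      unfolding X_def by (rule sum_diff[symmetric]) (use F F_mono that in auto)
    moreover have "b m - b n = (\<Sum>i\<in>F m - F n. (cmod (ip f (e i)))\<^sup>2)"
      unfolding b_def by (rule sum_diff[symmetric]) (use F F_mono that in auto)
    ultimately show ?thesis using bessel_synthesis_bound[OF e, of "F m - F n"] F by simp
  qed
  moreover have "b n \<le> (nrm f)\<^sup>2" for n
    using e f F by (auto simp: bessel_def b_def)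
  ultimately obtain s where s: "s \<in> H" "(\<lambda>n. nrm (X n - s)) \<longlonglongrightarrow> 0"
    using complete_monotone[of X b] XH by blast
  have Xg: "ip (X n) g = (\<Sum>i\<in>F n. ip f (e i) * ip (e i) g)" if "g \<in> H" for n g
    unfolding X_def using that eH by (subst ip_sum_left) (auto simp: ip_scale_left)
  show ?thesis
  proof (rule that)
    have "X n \<in> span (range e)" for n
      unfolding X_def by (intro span_sum span_scale span_base) auto
    then have "X n \<in> cl (span (range e))" for n
      using cl_superset[OF span_subset_H[OF range]] by blast
    then show "s \<in> cl (span (range e))"
      using closed_subspace_limit[OF closed_subspace_cl_span[OF range] _ s] by blast
  next
    fix g assume g: "g \<in> H"
    let ?h = "\<lambda>i. ip f (e i) * ip (e i) g"
    have "(\<lambda>i. (cmod (ip f (e i)))\<^sup>2 + (cmod (ip g (e i)))\<^sup>2) summable_on UNIV"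
      by (intro summable_on_add bessel_summable e f g)
    moreover have "norm (?h i) \<le> (cmod (ip f (e i)))\<^sup>2 + (cmod (ip g (e i)))\<^sup>2" for i
    proof -
      have "2 * (cmod (ip f (e i)) * cmod (ip g (e i)))
          \<le> (cmod (ip f (e i)))\<^sup>2 + (cmod (ip g (e i)))\<^sup>2"
        using sum_squares_bound[of "cmod (ip f (e i))" "cmod (ip g (e i))"] by simp
      moreover have "0 \<le> cmod (ip f (e i)) * cmod (ip g (e i))" by simp
      ultimately have "cmod (ip f (e i)) * cmod (ip g (e i))
          \<le> (cmod (ip f (e i)))\<^sup>2 + (cmod (ip g (e i)))\<^sup>2" by linarith
      then show ?thesis by (simp add: norm_mult ip_cmod_commute[OF g eH])
    qed
    ultimately have "(\<lambda>i. norm (?h i)) summable_on UNIV"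
      by (rule summable_on_comparison_test) auto
    then have "?h summable_on UNIV" by (rule abs_summable_summable)
    then have sum: "(?h has_sum infsum ?h UNIV) UNIV" by (rule has_sum_infsum)
    then have "(\<lambda>n. sum ?h (F n)) \<longlonglongrightarrow> infsum ?h UNIV"
      unfolding has_sum_def by (rule filterlim_compose[OF _ F_lim])
    moreover have "(\<lambda>n. sum ?h (F n)) \<longlonglongrightarrow> ip s g"
      using tendsto_ip_left[OF XH s(1) g s(2)] by (simp add: Xg[OF g])
    ultimately have "infsum ?h UNIV = ip s g" by (rule LIMSEQ_unique)
    then show "(?h has_sum ip s g) UNIV" using sum by simp
  next
    have "Re (ip (X n) f) = b n" for n
      using f eH by (simp add: Xg b_def ip_mult_swap flip: of_real_power)
    then have *: "b \<longlonglongrightarrow> Re (ip s f)"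
      using tendsto_Re[OF tendsto_ip_left[OF XH s(1) f s(2)]] by simp
    have "(\<lambda>n. (nrm (X n))\<^sup>2) \<longlonglongrightarrow> (nrm s)\<^sup>2"
      by (intro tendsto_power tendsto_nrm XH s)
    then show "(nrm s)\<^sup>2 \<le> Re (ip s f)"
      using * Xb by (intro LIMSEQ_le[OF _ *]) auto
  qed
qed

text \<open>The weak defining property fixes the value only up to a null vector, hence the choice of
  a representative. Linearity of this map is therefore available only after pairing.\<close>

definition frame_op :: "('i::countable \<Rightarrow> 'v) \<Rightarrow> 'v \<Rightarrow> 'v" where
  "frame_op e f = (SOME s. s \<in> cl (span (range e)) \<and>
     (\<forall>g\<in>H. ((\<lambda>i. ip f (e i) * ip (e i) g) has_sum ip s g) UNIV) \<and> (nrm s)\<^sup>2 \<le> Re (ip s f))"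

lemma
  fixes e :: "'i::countable \<Rightarrow> 'v"
  assumes "bessel e" and "f \<in> H"
  shows frame_op_cl: "frame_op e f \<in> cl (span (range e))"
    and frame_op_has_sum:
      "g \<in> H \<Longrightarrow> ((\<lambda>i. ip f (e i) * ip (e i) g) has_sum ip (frame_op e f) g) UNIV"
    and frame_op_nrm: "(nrm (frame_op e f))\<^sup>2 \<le> Re (ip (frame_op e f) f)"
proof -
  have "\<exists>s. s \<in> cl (span (range e)) \<and>
     (\<forall>g\<in>H. ((\<lambda>i. ip f (e i) * ip (e i) g) has_sum ip s g) UNIV) \<and> (nrm s)\<^sup>2 \<le> Re (ip s f)"
    using bessel_synthesis[OF assms] by metis
  from someI_ex[OF this] show "frame_op e f \<in> cl (span (range e))"
    and "g \<in> H \<Longrightarrow> ((\<lambda>i. ip f (e i) * ip (e i) g) has_sum ip (frame_op e f) g) UNIV"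
    and "(nrm (frame_op e f))\<^sup>2 \<le> Re (ip (frame_op e f) f)"
    unfolding frame_op_def by blast+
qed

lemma frame_op_self_has_sum:
  fixes e :: "'i::countable \<Rightarrow> 'v"
  assumes e: "bessel e" and f: "f \<in> H"
  shows "((\<lambda>i. (cmod (ip f (e i)))\<^sup>2) has_sum Re (ip (frame_op e f) f)) UNIV"
proof -
  have eH: "e i \<in> H" for i using e by (auto simp: bessel_def)
  have "((\<lambda>i. Re (ip f (e i) * ip (e i) f)) has_sum Re (ip (frame_op e f) f)) UNIV"
    by (rule has_sum_Re[OF frame_op_has_sum[OF e f f]])
  then show ?thesis using f eH by (simp add: ip_mult_swap flip: of_real_power)
qed

end

section \<open>The binomial series of exponent $-1/2$\<close>

text \<open>The coefficient of x^k in (1 - x) powr (-1/2), that is, (2 k choose k) / 4^k.\<close>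

definition bcoeff :: "nat \<Rightarrow> real" where
  "bcoeff k = (-1) ^ k * ((-1/2) gchoose k)"

lemma bcoeff_Suc: "bcoeff (Suc k) = bcoeff k * ((2 * real k + 1) / (2 * real k + 2))"
proof -
  let ?g = "\<lambda>k. (-1/2 :: real) gchoose k"
  have "real (Suc k) * ?g (Suc k) = (-1/2 - real k) * ?g k"
    using gbinomial_mult_1[of "-1/2 :: real" k] by (simp add: algebra_simps)
  then have "?g (Suc k) = - ((2 * real k + 1) / (2 * real k + 2)) * ?g k"
    by (simp add: field_simps)
  then show ?thesis by (simp add: bcoeff_def)
qed

lemma bcoeff_pos: "bcoeff k > 0"
proof (induction k)
  case 0
  then show ?case by (simp add: bcoeff_def)
next
  case (Suc k)
  then show ?case by (simp add: bcoeff_Suc add_nonneg_pos)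
qed

text \<open>Squaring (1 - x) powr (-1/2) gives the geometric series: Vandermonde with -1/2 + (-1/2)
  = -1.\<close>

lemma bcoeff_convolution: "(\<Sum>i\<le>k. bcoeff i * bcoeff (k - i)) = 1"
proof -
  have "(\<Sum>i\<le>k. bcoeff i * bcoeff (k - i))
      = (\<Sum>i\<le>k. (-1) ^ k * (((-1/2) gchoose i) * ((-1/2) gchoose (k - i))))"
    by (intro sum.cong refl) (simp add: bcoeff_def flip: power_add)
  also have "\<dots> = (-1) ^ k * ((-1/2 + (-1/2)) gchoose k)"
    unfolding sum_distrib_left[symmetric] atMost_atLeast0 by (subst gbinomial_Vandermonde) simp
  also have "\<dots> = (1::real)"
    using gbinomial_minus[of "1::real" k] by (simp add: binomial_gbinomial[symmetric] flip: power_add)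
  finally show ?thesis .
qed

text \<open>For m k = <A^k f, f> with A self-adjoint this is |q(A) f|^2, where q is the part of the
  binomial series with exponents in I.\<close>

definition bform :: "nat set \<Rightarrow> (nat \<Rightarrow> real) \<Rightarrow> real" where
  "bform I m = (\<Sum>i\<in>I. \<Sum>j\<in>I. bcoeff i * bcoeff j * m (i + j))"

text \<open>Collect terms by total degree k = i + j; by \<open>bcoeff_convolution\<close> a complete
  diagonal has total weight 1.\<close>

lemma bform_triangle:
  "(\<Sum>(i, j)\<in>{(i, j). i + j \<le> N}. bcoeff i * bcoeff j * m (i + j)) = (\<Sum>k\<le>N. m k)"
  by (simp add: sum.triangle_reindex_eq bcoeff_convolution flip: sum_distrib_right)

lemma bform_alt: "bform I m = (\<Sum>(i, j)\<in>I \<times> I. bcoeff i * bcoeff j * m (i + j))"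
  by (simp add: bform_def sum.cartesian_product)

lemma finite_triangle: "finite {(i, j). i + j \<le> (N::nat)}"
  by (rule finite_subset[of _ "{..N} \<times> {..N}"]) auto

text \<open>The index square with side {..N} contains the triangle i + j \<le> N and lies inside the
  triangle i + j \<le> 2 N. With nonnegative terms this yields both this bound and
  \<open>bform_upper\<close>.\<close>

lemma bform_lower: "(\<And>k. 0 \<le> m k) \<Longrightarrow> (\<Sum>k\<le>N. m k) \<le> bform {..N} m"
  unfolding bform_alt bform_triangle[symmetric]
  by (intro sum_mono2) (auto simp: less_imp_le[OF bcoeff_pos])

lemma bform_upper: "(\<And>k. 0 \<le> m k) \<Longrightarrow> bform {..N} m \<le> (\<Sum>k\<le>2 * N. m k)"
  unfolding bform_alt bform_triangle[symmetric]
  by (intro sum_mono2) (auto simp: less_imp_le[OF bcoeff_pos] finite_triangle)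

lemma bform_increment:
  assumes m: "\<And>k. 0 \<le> m k" and "N \<le> M"
  shows "bform {N<..M} m \<le> bform {..M} m - bform {..N} m"
proof -
  have "bform {..M} m - bform {..N} m
      = (\<Sum>(i, j)\<in>{..M} \<times> {..M} - {..N} \<times> {..N}. bcoeff i * bcoeff j * m (i + j))"
    unfolding bform_alt using assms(2) by (intro sum_diff[symmetric]) auto
  moreover have "bform {N<..M} m \<le> \<dots>"
    unfolding bform_alt using m
    by (intro sum_mono2) (auto simp: less_imp_le[OF bcoeff_pos])
  ultimately show ?thesis by simp
qed

lemma bform_diff: "bform I (\<lambda>k. m k - n k) = bform I m - bform I n"
  by (simp add: bform_def algebra_simps sum_subtractf)

lemma sum_telescope_atMost: "(\<Sum>k\<le>N. m k - m (Suc k)) = m 0 - (m (Suc N) :: real)"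
  by (induction N) auto

section \<open>Parseval generators of cyclic subspaces\<close>

text \<open>\<open>U_U\<close> and \<open>U_0\<close> are demanded after pairing because the
  Jacobian cocycle relation, and with it the group law of the representation, holds only almost
  everywhere.\<close>

locale unitary_rep = semi_hilbert scale H ip
  for scale :: "complex \<Rightarrow> 'v::ab_group_add \<Rightarrow> 'v" and H :: "'v set" and ip :: "'v \<Rightarrow> 'v \<Rightarrow> complex" +
  fixes U :: "'g::{countable, group_add} \<Rightarrow> 'v \<Rightarrow> 'v"
  assumes U_H [simp]: "\<And>\<gamma> f. f \<in> H \<Longrightarrow> U \<gamma> f \<in> H"
    and U_add: "\<And>\<gamma> f g. f \<in> H \<Longrightarrow> g \<in> H \<Longrightarrow> U \<gamma> (f + g) = U \<gamma> f + U \<gamma> g"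
    and U_scale: "\<And>\<gamma> c f. f \<in> H \<Longrightarrow> U \<gamma> (scale c f) = scale c (U \<gamma> f)"
    and U_ip: "\<And>\<gamma> f g. f \<in> H \<Longrightarrow> g \<in> H \<Longrightarrow> ip (U \<gamma> f) (U \<gamma> g) = ip f g"
    and U_U: "\<And>\<gamma> \<delta> f g. f \<in> H \<Longrightarrow> g \<in> H \<Longrightarrow> ip (U \<gamma> (U \<delta> f)) g = ip (U (\<gamma> + \<delta>) f) g"
    and U_0: "\<And>f g. f \<in> H \<Longrightarrow> g \<in> H \<Longrightarrow> ip (U 0 f) g = ip f g"
begin

lemma U_diff: "f \<in> H \<Longrightarrow> g \<in> H \<Longrightarrow> U \<gamma> (f - g) = U \<gamma> f - U \<gamma> g"
  using U_add[of "f - g" g \<gamma>] by simp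

lemma U_nrm [simp]: "f \<in> H \<Longrightarrow> nrm (U \<gamma> f) = nrm f"
  by (simp add: nrm_def U_ip)

lemma U_U_right: "f \<in> H \<Longrightarrow> g \<in> H \<Longrightarrow> ip g (U \<gamma> (U \<delta> f)) = ip g (U (\<gamma> + \<delta>) f)"
  using arg_cong[OF U_U[of f g \<gamma> \<delta>], of cnj] by (simp add: ip_cnj)

lemma U_adjoint:
  assumes "f \<in> H" "g \<in> H"
  shows "ip (U \<gamma> f) g = ip f (U (- \<gamma>) g)"
proof -
  have "ip (U \<gamma> f) g = ip (U (- \<gamma>) (U \<gamma> f)) (U (- \<gamma>) g)"
    using assms by (simp add: U_ip)
  also have "\<dots> = ip f (U (- \<gamma>) g)"
    using assms by (simp add: U_U U_0)
  finally show ?thesis .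
qed

definition cyclic :: "'v \<Rightarrow> 'v set" where
  "cyclic \<psi> = cl (span (range (\<lambda>\<gamma>. U \<gamma> \<psi>)))"

definition invariant :: "'v set \<Rightarrow> bool" where
  "invariant K \<longleftrightarrow> closed_subspace K \<and> (\<forall>f\<in>K. \<forall>\<gamma>. U \<gamma> f \<in> K)"

lemma orbit_subset_H: "\<psi> \<in> H \<Longrightarrow> range (\<lambda>\<gamma>. U \<gamma> \<psi>) \<subseteq> H"
  by auto

lemma closed_subspace_cyclic: "\<psi> \<in> H \<Longrightarrow> closed_subspace (cyclic \<psi>)"
  unfolding cyclic_def by (rule closed_subspace_cl_span[OF orbit_subset_H])

lemma orbit_in_cyclic: "\<psi> \<in> H \<Longrightarrow> U \<gamma> \<psi> \<in> cyclic \<psi>"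
  unfolding cyclic_def using cl_span_superset[OF orbit_subset_H] by blast

text \<open>Lets invariance of a generated closed subspace be checked on its generators. Closedness
  of the preimage holds because \<open>U \<gamma>\<close> is isometric.\<close>

lemma closed_subspace_preimage:
  assumes K: "closed_subspace K"
  shows "closed_subspace {f \<in> H. U \<gamma> f \<in> K}" (is "closed_subspace ?P")
  unfolding closed_subspace_def
proof (intro conjI)
  have sub: "subspace K" and KH: "K \<subseteq> H" using K by (auto simp: closed_subspace_def)
  have U0: "U \<gamma> 0 = 0" using U_diff[of 0 0] by simp
  show P: "?P \<subseteq> H" by auto
  show "subspace ?P"
    by (rule subspaceI) (auto simp: U0 U_add U_scale subspace_0[OF sub] subspace_add[OF sub] subspace_scale[OF sub])
  have "f \<in> ?P" if f: "f \<in> cl ?P" for f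
  proof -
    have fH: "f \<in> H" using f cl_subset_H by blast
    have "\<exists>g\<in>K. nrm (U \<gamma> f - g) < e" if e: "e > 0" for e
    proof -
      obtain g where g: "g \<in> H" "U \<gamma> g \<in> K" "nrm (f - g) < e"
        using f e unfolding cl_def by (auto dest!: spec[of _ e])
      then have "nrm (U \<gamma> f - U \<gamma> g) < e" using fH by (simp flip: U_diff)
      then show ?thesis using g by blast
    qed
    then have "U \<gamma> f \<in> cl K" using fH by (auto simp: cl_def)
    then show ?thesis using K fH by (simp add: closed_subspace_def)
  qed
  then show "cl ?P = ?P" using cl_superset[OF P] by blast
qed

lemma invariant_cyclic:
  assumes \<psi>: "\<psi> \<in> H"
  shows "invariant (cyclic \<psi>)"
proof -
  have "U \<gamma> (U \<delta> \<psi>) \<in> cyclic \<psi>" for \<gamma> \<delta>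
  proof (rule closed_subspace_null[OF closed_subspace_cyclic[OF \<psi>] orbit_in_cyclic[OF \<psi>]])
    show "nrm (U (\<gamma> + \<delta>) \<psi> - U \<gamma> (U \<delta> \<psi>)) = 0"
      using \<psi> by (intro nrm_le_of_ip) (simp_all add: ip_diff_left U_U)
  qed (use \<psi> in simp)
  then have "cyclic \<psi> \<subseteq> {f \<in> H. U \<gamma> f \<in> cyclic \<psi>}" for \<gamma>
    unfolding cyclic_def[of \<psi>]
    by (intro cl_span_minimal) (use \<psi> closed_subspace_preimage[OF closed_subspace_cyclic[OF \<psi>]] in \<open>auto simp: cyclic_def\<close>)
  then show ?thesis unfolding invariant_def using closed_subspace_cyclic[OF \<psi>] by blast
qed

lemma cyclic_minimal:
  assumes "invariant K" "\<psi> \<in> K"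
  shows "cyclic \<psi> \<subseteq> K"
  unfolding cyclic_def using assms by (intro cl_span_minimal) (auto simp: invariant_def)

text \<open>Undoing \<open>U \<gamma>\<close> by \<open>U (- \<gamma>)\<close> recovers f up to a
  null vector, which K absorbs. It is used to place a generator in its own cyclic space, since the
  orbit contains it only up to a null vector.\<close>

lemma self_in_invariant:
  assumes K: "invariant K" and "U \<gamma> f \<in> K" "f \<in> H"
  shows "f \<in> K"
proof (rule closed_subspace_null)
  show "closed_subspace K" "U (- \<gamma>) (U \<gamma> f) \<in> K" using assms by (auto simp: invariant_def)
  show "nrm (U (- \<gamma>) (U \<gamma> f) - f) = 0"
    using assms(3) by (intro nrm_le_of_ip) (simp_all add: ip_diff_left U_U U_0)
qed fact

lemma self_in_cyclic: "\<psi> \<in> H \<Longrightarrow> \<psi> \<in> cyclic \<psi>"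
  using self_in_invariant[OF invariant_cyclic orbit_in_cyclic] by blast

section \<open>The positive operator 1 - S and its moments\<close>

definition defect :: "'v \<Rightarrow> 'v \<Rightarrow> 'v" where
  "defect \<eta> f = f - frame_op (\<lambda>\<gamma>. U \<gamma> \<eta>) f"

definition moment :: "'v \<Rightarrow> nat \<Rightarrow> 'v \<Rightarrow> real" where
  "moment \<eta> k f = Re (ip ((defect \<eta> ^^ k) f) f)"

text \<open>For \<open>I = {..N}\<close>, a partial sum of the binomial series of \<open>S powr (-1/2)\<close> applied to \<open>f\<close>,
  where \<open>S = 1 - defect \<eta>\<close> is the frame operator of the orbit of \<open>\<eta>\<close>.\<close>

definition psum :: "'v \<Rightarrow> nat set \<Rightarrow> 'v \<Rightarrow> 'v" where
  "psum \<eta> I f = (\<Sum>k\<in>I. scale (of_real (bcoeff k)) ((defect \<eta> ^^ k) f))"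

context
  fixes \<eta> :: 'v
  assumes \<eta>: "\<eta> \<in> H" and bessel: "bessel (\<lambda>\<gamma>. U \<gamma> \<eta>)"
begin

lemma frame_op_in_H [simp]: "f \<in> H \<Longrightarrow> frame_op (\<lambda>\<gamma>. U \<gamma> \<eta>) f \<in> H"
  using frame_op_cl[OF bessel] cl_subset_H by blast

lemma defect_H [simp]: "f \<in> H \<Longrightarrow> defect \<eta> f \<in> H"
  by (simp add: defect_def)

lemma defect_pow_H [simp]: "f \<in> H \<Longrightarrow> (defect \<eta> ^^ k) f \<in> H"
  by (induction k) auto

lemma frame_op_adjoint:
  assumes f: "f \<in> H" and g: "g \<in> H"
  shows "ip (frame_op (\<lambda>\<gamma>. U \<gamma> \<eta>) f) g = ip f (frame_op (\<lambda>\<gamma>. U \<gamma> \<eta>) g)"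
proof -
  have "((\<lambda>\<gamma>. cnj (ip g (U \<gamma> \<eta>) * ip (U \<gamma> \<eta>) f)) has_sum
      cnj (ip (frame_op (\<lambda>\<gamma>. U \<gamma> \<eta>) g) f)) UNIV"
    using frame_op_has_sum[OF bessel g f] by (rule has_sum_cnj_iff[THEN iffD2])
  then have "((\<lambda>\<gamma>. ip f (U \<gamma> \<eta>) * ip (U \<gamma> \<eta>) g) has_sum
      ip f (frame_op (\<lambda>\<gamma>. U \<gamma> \<eta>) g)) UNIV"
    using f g \<eta> by (simp add: ip_cnj mult.commute)
  then show ?thesis
    using frame_op_has_sum[OF bessel f g] has_sum_unique by blast
qed

text \<open>Translation by \<open>- \<delta>\<close> permutes the group, so reindexing the frame sum
  turns coefficients of f into coefficients of \<open>U \<delta> f\<close>. This commutation is the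
  only use of the orbit structure of the family.\<close>

lemma frame_op_commute:
  assumes f: "f \<in> H" and g: "g \<in> H"
  shows "ip (frame_op (\<lambda>\<gamma>. U \<gamma> \<eta>) (U \<delta> f)) g = ip (U \<delta> (frame_op (\<lambda>\<gamma>. U \<gamma> \<eta>) f)) g"
proof -
  let ?h = "\<lambda>\<gamma>. ip f (U \<gamma> \<eta>) * ip (U \<gamma> \<eta>) (U (- \<delta>) g)"
  have "(?h has_sum ip (frame_op (\<lambda>\<gamma>. U \<gamma> \<eta>) f) (U (- \<delta>) g)) UNIV"
    using f g by (intro frame_op_has_sum bessel) auto
  moreover have "bij (\<lambda>\<gamma>. - \<delta> + \<gamma>)"
    by (rule bijI) (auto simp: inj_def surj_def intro!: exI[of _ "\<delta> + _"] simp flip: add.assoc)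
  ultimately have "((\<lambda>\<gamma>. ?h (- \<delta> + \<gamma>)) has_sum ip (frame_op (\<lambda>\<gamma>. U \<gamma> \<eta>) f) (U (- \<delta>) g)) UNIV"
    using has_sum_reindex_bij_betw[of "\<lambda>\<gamma>. - \<delta> + \<gamma>" UNIV UNIV ?h] by simp
  moreover have "?h (- \<delta> + \<gamma>) = ip (U \<delta> f) (U \<gamma> \<eta>) * ip (U \<gamma> \<eta>) g" for \<gamma>
  proof -
    have "ip (U (- \<delta> + \<gamma>) \<eta>) (U (- \<delta>) g) = ip (U (- \<delta>) (U \<gamma> \<eta>)) (U (- \<delta>) g)"
      using \<eta> g by (simp add: U_U)
    then show ?thesis
      using \<eta> f g by (simp add: U_adjoint[of f "U \<gamma> \<eta>" \<delta>] U_U_right U_ip)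
  qed
  ultimately have "((\<lambda>\<gamma>. ip (U \<delta> f) (U \<gamma> \<eta>) * ip (U \<gamma> \<eta>) g) has_sum
      ip (frame_op (\<lambda>\<gamma>. U \<gamma> \<eta>) f) (U (- \<delta>) g)) UNIV"
    by simp
  moreover have "((\<lambda>\<gamma>. ip (U \<delta> f) (U \<gamma> \<eta>) * ip (U \<gamma> \<eta>) g) has_sum
      ip (frame_op (\<lambda>\<gamma>. U \<gamma> \<eta>) (U \<delta> f)) g) UNIV"
    using f g by (intro frame_op_has_sum bessel) auto
  ultimately have "ip (frame_op (\<lambda>\<gamma>. U \<gamma> \<eta>) (U \<delta> f)) g = ip (frame_op (\<lambda>\<gamma>. U \<gamma> \<eta>) f) (U (- \<delta>) g)"
    using has_sum_unique by blast
  then show ?thesis using f g by (simp add: U_adjoint)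
qed

lemma defect_adjoint: "f \<in> H \<Longrightarrow> g \<in> H \<Longrightarrow> ip (defect \<eta> f) g = ip f (defect \<eta> g)"
  by (simp add: defect_def ip_diff_left ip_diff_right frame_op_adjoint)

lemma defect_pow_adjoint:
  "f \<in> H \<Longrightarrow> g \<in> H \<Longrightarrow> ip ((defect \<eta> ^^ k) f) g = ip f ((defect \<eta> ^^ k) g)"
proof (induction k arbitrary: f)
  case (Suc k)
  have "ip ((defect \<eta> ^^ Suc k) f) g = ip (defect \<eta> f) ((defect \<eta> ^^ k) g)"
    using Suc by (simp add: funpow_Suc_right del: funpow.simps)
  then show ?case using Suc.prems by (simp add: defect_adjoint)
qed simp

lemma defect_commute:
  "f \<in> H \<Longrightarrow> g \<in> H \<Longrightarrow> ip (defect \<eta> (U \<delta> f)) g = ip (U \<delta> (defect \<eta> f)) g"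
  by (simp add: defect_def ip_diff_left U_diff frame_op_commute)

lemma defect_pow_commute:
  "f \<in> H \<Longrightarrow> g \<in> H \<Longrightarrow> ip ((defect \<eta> ^^ k) (U \<delta> f)) g = ip (U \<delta> ((defect \<eta> ^^ k) f)) g"
proof (induction k arbitrary: g)
  case (Suc k)
  then have "ip ((defect \<eta> ^^ Suc k) (U \<delta> f)) g = ip (U \<delta> ((defect \<eta> ^^ k) f)) (defect \<eta> g)"
    by (simp add: defect_adjoint)
  also have "\<dots> = ip (U \<delta> ((defect \<eta> ^^ Suc k) f)) g"
    using Suc.prems by (simp add: defect_commute flip: defect_adjoint)
  finally show ?case .
qed simp

lemma frame_op_self:
  assumes f: "f \<in> H"
  shows "0 \<le> Re (ip (frame_op (\<lambda>\<gamma>. U \<gamma> \<eta>) f) f)"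
    and "Re (ip (frame_op (\<lambda>\<gamma>. U \<gamma> \<eta>) f) f) \<le> (nrm f)\<^sup>2"
proof -
  note s = frame_op_self_has_sum[OF bessel f]
  show "0 \<le> Re (ip (frame_op (\<lambda>\<gamma>. U \<gamma> \<eta>) f) f)"
    using s by (rule has_sum_nonneg) auto
  show "Re (ip (frame_op (\<lambda>\<gamma>. U \<gamma> \<eta>) f) f) \<le> (nrm f)\<^sup>2"
    using s by (rule has_sum_le_finite_sums) (use bessel f in \<open>auto simp: bessel_def\<close>)
qed

text \<open>The third bound is A^2 \<le> A: since A^2 = 1 - 2 S + S^2, it amounts to S^2 \<le> S,
  that is, to \<open>frame_op_nrm\<close>.\<close>

lemma defect_self:
  assumes f: "f \<in> H"
  shows "0 \<le> Re (ip (defect \<eta> f) f)"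
    and "Re (ip (defect \<eta> f) f) \<le> (nrm f)\<^sup>2"
    and "(nrm (defect \<eta> f))\<^sup>2 \<le> Re (ip (defect \<eta> f) f)"
proof -
  let ?S = "frame_op (\<lambda>\<gamma>. U \<gamma> \<eta>) f"
  have *: "Re (ip (defect \<eta> f) f) = (nrm f)\<^sup>2 - Re (ip ?S f)"
    using f by (simp add: defect_def ip_diff_left nrm_sq)
  show "0 \<le> Re (ip (defect \<eta> f) f)" "Re (ip (defect \<eta> f) f) \<le> (nrm f)\<^sup>2"
    using frame_op_self[OF f] by (simp_all add: *)
  have "(nrm (defect \<eta> f))\<^sup>2 = (nrm f)\<^sup>2 + (nrm ?S)\<^sup>2 - 2 * Re (ip ?S f)"
    using f by (simp add: defect_def nrm_diff_sq frame_op_adjoint)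
  then show "(nrm (defect \<eta> f))\<^sup>2 \<le> Re (ip (defect \<eta> f) f)"
    using frame_op_nrm[OF bessel f] by (simp add: *)
qed

lemma defect_pow_ip:
  assumes "f \<in> H" "g \<in> H"
  shows "ip ((defect \<eta> ^^ i) f) ((defect \<eta> ^^ j) g) = ip ((defect \<eta> ^^ (i + j)) f) g"
  using assms by (subst add.commute) (simp add: funpow_add defect_pow_adjoint)

lemma moment_even: "f \<in> H \<Longrightarrow> moment \<eta> (k + k) f = (nrm ((defect \<eta> ^^ k) f))\<^sup>2"
  by (simp add: moment_def nrm_sq defect_pow_ip)

lemma moment_odd:
  "f \<in> H \<Longrightarrow> moment \<eta> (Suc (k + k)) f = Re (ip (defect \<eta> ((defect \<eta> ^^ k) f)) ((defect \<eta> ^^ k) f))"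
  using defect_pow_ip[of f f "Suc k" k] by (simp add: moment_def)

lemma moment_nonneg: "f \<in> H \<Longrightarrow> 0 \<le> moment \<eta> k f"
  using moment_even[of f "k div 2"] moment_odd[of f "k div 2"] defect_self(1)[of "(defect \<eta> ^^ (k div 2)) f"]
  by (cases "even k") (auto elim!: evenE oddE simp: mult_2)

text \<open>Put h = A^(k div 2) f. For even k the claim is <A h, h> \<le> |h|^2, for odd k it is |A
  h|^2 \<le> <A h, h>; both are in \<open>defect_self\<close>.\<close>

lemma moment_decreasing:
  assumes f: "f \<in> H"
  shows "moment \<eta> (Suc k) f \<le> moment \<eta> k f"
proof (cases "even k")
  case True
  then obtain j where j: "k = j + j" by (metis evenE mult_2)
  show ?thesis unfolding j moment_even[OF f] moment_odd[OF f]
    using f by (intro defect_self) simp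
next
  case False
  then obtain j where j: "k = Suc (j + j)" by (metis oddE mult_2 Suc_eq_plus1)
  have "Suc (Suc (j + j)) = Suc j + Suc j" by simp
  then show ?thesis unfolding j moment_odd[OF f]
    using defect_self(3)[of "(defect \<eta> ^^ j) f"] f moment_even[OF f, of "Suc j"] by simp
qed

lemma moment_antimono: "f \<in> H \<Longrightarrow> i \<le> j \<Longrightarrow> moment \<eta> j f \<le> moment \<eta> i f"
  using lift_Suc_antimono_le[of "\<lambda>k. moment \<eta> k f"] moment_decreasing by blast

lemma moment_0: "f \<in> H \<Longrightarrow> moment \<eta> 0 f = (nrm f)\<^sup>2"
  by (simp add: moment_def nrm_sq)

lemma moment_U: "f \<in> H \<Longrightarrow> moment \<eta> k (U \<gamma> f) = moment \<eta> k f"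
  by (simp add: moment_def defect_pow_commute U_ip)

lemma defect_pow_nrm_le: "f \<in> H \<Longrightarrow> nrm ((defect \<eta> ^^ k) f) \<le> nrm f"
  using moment_antimono[of f 0 "k + k"] moment_even[of f k] moment_0[of f]
  by (auto intro: power2_le_imp_le)

section \<open>Truncated binomial series and the Bessel sums of their orbits\<close>

lemma psum_H [simp]: "f \<in> H \<Longrightarrow> psum \<eta> I f \<in> H"
  unfolding psum_def by (intro H_sum) auto

lemma ip_psum_left:
  "f \<in> H \<Longrightarrow> g \<in> H \<Longrightarrow> ip (psum \<eta> I f) g = (\<Sum>k\<in>I. of_real (bcoeff k) * ip ((defect \<eta> ^^ k) f) g)"
  unfolding psum_def by (subst ip_sum_left) (auto simp: ip_scale_left)

lemma ip_psum_right:
  "f \<in> H \<Longrightarrow> g \<in> H \<Longrightarrow> ip g (psum \<eta> I f) = (\<Sum>k\<in>I. of_real (bcoeff k) * ip g ((defect \<eta> ^^ k) f))"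
  unfolding psum_def by (subst ip_sum_right) (auto simp: ip_scale_right)

lemma psum_nrm:
  assumes f: "f \<in> H"
  shows "(nrm (psum \<eta> I f))\<^sup>2 = bform I (\<lambda>k. moment \<eta> k f)"
proof -
  have "ip (psum \<eta> I f) (psum \<eta> I f)
      = (\<Sum>i\<in>I. \<Sum>j\<in>I. of_real (bcoeff i * bcoeff j) * ip ((defect \<eta> ^^ (i + j)) f) f)"
    using f by (subst ip_psum_left; simp add: ip_psum_right defect_pow_ip sum_distrib_left mult.assoc)
  then show ?thesis
    using f by (simp add: nrm_sq bform_def moment_def del: of_real_mult)
qed

text \<open>\<open>defect \<eta>\<close> is linear only up to null vectors, so it is moved across
  the pairing before a partial sum is expanded.\<close>

lemma psum_defect:
  assumes f: "f \<in> H"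
  shows "Re (ip (defect \<eta> (psum \<eta> I f)) (psum \<eta> I f)) = bform I (\<lambda>k. moment \<eta> (Suc k) f)"
proof -
  have *: "ip ((defect \<eta> ^^ i) f) (defect \<eta> ((defect \<eta> ^^ j) f)) = ip ((defect \<eta> ^^ Suc (i + j)) f) f" for i j
    using defect_pow_ip[OF f f, of i "Suc j"] by simp
  have "ip (defect \<eta> (psum \<eta> I f)) (psum \<eta> I f) = ip (psum \<eta> I f) (defect \<eta> (psum \<eta> I f))"
    using f by (simp add: defect_adjoint)
  also have "\<dots> = (\<Sum>i\<in>I. of_real (bcoeff i) * ip (defect \<eta> ((defect \<eta> ^^ i) f)) (psum \<eta> I f))"
    using f by (simp add: ip_psum_left defect_adjoint)
  also have "\<dots> = (\<Sum>i\<in>I. \<Sum>j\<in>I. of_real (bcoeff i * bcoeff j) * ip ((defect \<eta> ^^ Suc (i + j)) f) f)"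
    using f * by (simp add: ip_psum_right sum_distrib_left mult.assoc defect_adjoint del: funpow.simps)
  finally show ?thesis
    by (simp add: bform_def moment_def del: of_real_mult funpow.simps)
qed

text \<open>Self-adjointness and commutation with the representation shift q(A) from the generator
  to f, so the orbit of q(A) \<open>\<eta>\<close> can be studied through the Bessel orbit of
  \<open>\<eta>\<close>.\<close>

lemma psum_orbit:
  assumes f: "f \<in> H"
  shows "ip f (U \<gamma> (psum \<eta> I \<eta>)) = ip (psum \<eta> I f) (U \<gamma> \<eta>)"
proof -
  have "ip f (U \<gamma> (psum \<eta> I \<eta>)) = ip (U (- \<gamma>) f) (psum \<eta> I \<eta>)"
    using f \<eta> by (simp add: U_adjoint)
  also have "\<dots> = (\<Sum>k\<in>I. of_real (bcoeff k) * ip ((defect \<eta> ^^ k) f) (U \<gamma> \<eta>))"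
    using f \<eta> by (simp add: ip_psum_right defect_pow_commute U_adjoint flip: defect_pow_adjoint)
  finally show ?thesis using f \<eta> by (simp add: ip_psum_left)
qed

text \<open>In operator terms the sum is <S q(A) f, q(A) f>; writing S = 1 - A replaces each moment
  by its difference with the next one.\<close>

lemma psum_orbit_has_sum:
  assumes f: "f \<in> H"
  shows "((\<lambda>\<gamma>. (cmod (ip f (U \<gamma> (psum \<eta> I \<eta>))))\<^sup>2) has_sum
    bform I (\<lambda>k. moment \<eta> k f - moment \<eta> (Suc k) f)) UNIV"
proof -
  let ?p = "psum \<eta> I f"
  have "((\<lambda>\<gamma>. (cmod (ip ?p (U \<gamma> \<eta>)))\<^sup>2) has_sum Re (ip (frame_op (\<lambda>\<gamma>. U \<gamma> \<eta>) ?p) ?p)) UNIV"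
    using f by (intro frame_op_self_has_sum bessel) simp
  moreover have "Re (ip (frame_op (\<lambda>\<gamma>. U \<gamma> \<eta>) ?p) ?p) = (nrm ?p)\<^sup>2 - Re (ip (defect \<eta> ?p) ?p)"
    using f by (simp add: defect_def ip_diff_left nrm_sq)
  ultimately show ?thesis
    using f by (simp add: psum_orbit psum_nrm psum_defect bform_diff)
qed

text \<open>Moment differences are nonnegative and telescope, so the triangle bounds apply to them.
  For the third bound, the block up to N already accounts for all of |f|^2 but one moment, and the
  block up to M cannot exceed |f|^2.\<close>

lemma psum_orbit_bounds:
  assumes f: "f \<in> H"
  shows "(nrm f)\<^sup>2 - moment \<eta> (Suc N) f \<le> bform {..N} (\<lambda>k. moment \<eta> k f - moment \<eta> (Suc k) f)"
    and "bform {..N} (\<lambda>k. moment \<eta> k f - moment \<eta> (Suc k) f) \<le> (nrm f)\<^sup>2"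
    and "N \<le> M \<Longrightarrow> bform {N<..M} (\<lambda>k. moment \<eta> k f - moment \<eta> (Suc k) f) \<le> moment \<eta> (Suc N) f"
proof -
  let ?d = "\<lambda>k. moment \<eta> k f - moment \<eta> (Suc k) f"
  have d: "0 \<le> ?d k" for k using moment_decreasing[OF f] by simp
  show 1: "(nrm f)\<^sup>2 - moment \<eta> (Suc N) f \<le> bform {..N} ?d" for N
    using bform_lower[of ?d N] d by (simp add: sum_telescope_atMost[of "\<lambda>k. moment \<eta> k f"] moment_0[OF f])
  have 2: "bform {..N} ?d \<le> (nrm f)\<^sup>2" for N
    using bform_upper[of ?d N] d moment_nonneg[OF f, of "Suc (2 * N)"]
    by (simp add: sum_telescope_atMost[of "\<lambda>k. moment \<eta> k f"] moment_0[OF f])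
  then show "bform {..N} ?d \<le> (nrm f)\<^sup>2" .
  show "bform {N<..M} ?d \<le> moment \<eta> (Suc N) f" if "N \<le> M"
    using bform_increment[of ?d N M, OF d that] 1[of N] 2[of M] by linarith
qed

text \<open>Test the upper bound \<open>psum_orbit_bounds\<close> on f = p, the partial sum itself,
  and keep only the term at the group identity: |p|^4 \<le> |p|^2. No convergence of the series is
  presupposed.\<close>

lemma psum_nrm_le: "nrm (psum \<eta> {..N} \<eta>) \<le> 1"
proof -
  let ?p = "psum \<eta> {..N} \<eta>"
  have p: "?p \<in> H" using \<eta> by simp
  have "(cmod (ip ?p (U 0 ?p)))\<^sup>2 \<le> bform {..N} (\<lambda>k. moment \<eta> k ?p - moment \<eta> (Suc k) ?p)"
    using has_sum_mono2[OF has_sum_finite[of "{0}"] psum_orbit_has_sum[OF p]] by simp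
  also have "\<dots> \<le> (nrm ?p)\<^sup>2" by (rule psum_orbit_bounds(2)[OF p])
  also have "ip ?p (U 0 ?p) = ip (U 0 ?p) ?p" using U_adjoint[OF p p, of 0] by simp
  finally have "((nrm ?p)\<^sup>2)\<^sup>2 \<le> (nrm ?p)\<^sup>2"
    using p by (simp add: U_0 ip_self norm_power)
  then have "(nrm ?p)\<^sup>2 * (nrm ?p)\<^sup>2 \<le> 1 * (nrm ?p)\<^sup>2"
    by (simp only: power2_eq_square[of "(nrm ?p)\<^sup>2"] mult_1)
  then have "(nrm ?p)\<^sup>2 \<le> 1"
    using mult_right_le_imp_le[of "(nrm ?p)\<^sup>2" "(nrm ?p)\<^sup>2" 1] by (cases "nrm ?p = 0") simp_all
  then show ?thesis using nrm_ge_0[OF p] by (simp add: power_le_one_iff abs_square_le_1)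
qed

text \<open>Boundedness of the partial sums controls the sum of the moments of \<open>\<eta>\<close>, which forces decay.\<close>

lemma moment_generator_bound: "moment \<eta> N \<eta> \<le> 1 / Suc N"
proof -
  have "(real (Suc N)) * moment \<eta> N \<eta> = (\<Sum>k\<le>N. moment \<eta> N \<eta>)" by simp
  also have "\<dots> \<le> (\<Sum>k\<le>N. moment \<eta> k \<eta>)"
    using \<eta> by (intro sum_mono moment_antimono) auto
  also have "\<dots> \<le> (nrm (psum \<eta> {..N} \<eta>))\<^sup>2"
    using \<eta> by (simp add: psum_nrm bform_lower moment_nonneg)
  also have "\<dots> \<le> 1" using psum_nrm_le \<eta> by (simp add: power_le_one)
  finally show ?thesis by (simp add: field_simps)
qed

text \<open>On the orbit, |A^N h|^2 is the moment of index 2 N, so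
  \<open>moment_generator_bound\<close> gives decay; \<open>defect_pow_nrm_le\<close> extends it to
  the closed span. The powers act on the fixed g so that linearity in f comes from the inner product
  alone.\<close>

lemma defect_pow_weak_limit:
  assumes f: "f \<in> cyclic \<eta>" and g: "g \<in> H"
  shows "(\<lambda>N. ip f ((defect \<eta> ^^ N) g)) \<longlonglongrightarrow> 0"
proof -
  define Z where "Z = {f \<in> H. (\<lambda>N. ip f ((defect \<eta> ^^ N) g)) \<longlonglongrightarrow> 0}"
  have ZH: "Z \<subseteq> H" by (auto simp: Z_def)
  have orbit: "U \<gamma> \<eta> \<in> Z" for \<gamma>
  proof -
    have "(\<lambda>N. ip (U \<gamma> \<eta>) ((defect \<eta> ^^ N) g)) \<longlonglongrightarrow> 0"
    proof (rule Lim_null_comparison[OF always_eventually], intro allI)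
      fix N
      let ?h = "(defect \<eta> ^^ N) (U \<gamma> \<eta>)"
      have "(nrm ?h)\<^sup>2 \<le> 1 / Suc (N + N)"
        using moment_even[of "U \<gamma> \<eta>" N] moment_U[of \<eta> "N + N" \<gamma>] moment_generator_bound[of "N + N"] \<eta> by simp
      also have "\<dots> \<le> 1 / Suc N" by (simp add: frac_le)
      finally have "nrm ?h \<le> sqrt (1 / Suc N)" by (rule real_le_rsqrt)
      then have "nrm ?h * nrm g \<le> sqrt (1 / Suc N) * nrm g"
        using g by (intro mult_right_mono) auto
      moreover have "cmod (ip (U \<gamma> \<eta>) ((defect \<eta> ^^ N) g)) \<le> nrm ?h * nrm g"
        using \<eta> g Cauchy_Schwarz[of ?h g] by (simp flip: defect_pow_adjoint)
      ultimately show "norm (ip (U \<gamma> \<eta>) ((defect \<eta> ^^ N) g)) \<le> sqrt (1 / Suc N) * nrm g" by linarith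
    next
      have "(\<lambda>N. sqrt (1 / Suc N) * nrm g) \<longlonglongrightarrow> sqrt 0 * nrm g"
        by (intro tendsto_intros LIMSEQ_Suc[OF lim_1_over_n])
      then show "(\<lambda>N. sqrt (1 / Suc N) * nrm g) \<longlonglongrightarrow> 0" by simp
    qed
    then show ?thesis using \<eta> by (simp add: Z_def)
  qed
  have "subspace Z"
  proof (rule subspaceI)
    show "0 \<in> Z" using g by (simp add: Z_def)
    show "x + y \<in> Z" if "x \<in> Z" "y \<in> Z" for x y
      using that g tendsto_add[of "\<lambda>N. ip x ((defect \<eta> ^^ N) g)" 0 sequentially "\<lambda>N. ip y ((defect \<eta> ^^ N) g)" 0]
      by (auto simp: Z_def ip_add_left)
    show "scale c x \<in> Z" if "x \<in> Z" for c x
      using that g tendsto_mult_right_zero[of "\<lambda>N. ip x ((defect \<eta> ^^ N) g)" sequentially c]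
      by (auto simp: Z_def ip_scale_left)
  qed
  moreover have "f \<in> Z" if f: "f \<in> cl Z" for f
  proof -
    have fH: "f \<in> H" using f cl_subset_H by blast
    have "\<exists>N0. \<forall>N\<ge>N0. cmod (ip f ((defect \<eta> ^^ N) g)) < e" if e: "e > 0" for e
    proof -
      have pos: "0 < nrm g + 1" using g by (simp add: add_nonneg_pos)
      then obtain s where s: "s \<in> Z" "nrm (f - s) < e / 2 / (nrm g + 1)"
        using f e unfolding cl_def by (auto dest!: spec[of _ "e / 2 / (nrm g + 1)"])
      then have sH: "s \<in> H" using ZH by blast
      obtain N0 where N0: "\<And>N. N \<ge> N0 \<Longrightarrow> cmod (ip s ((defect \<eta> ^^ N) g)) < e / 2"
        using s LIMSEQ_D[of "\<lambda>N. ip s ((defect \<eta> ^^ N) g)" 0 "e / 2"] e by (auto simp: Z_def)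
      have "cmod (ip f ((defect \<eta> ^^ N) g)) < e" if "N \<ge> N0" for N
      proof -
        let ?h = "(defect \<eta> ^^ N) g"
        have "cmod (ip (f - s) ?h) \<le> nrm (f - s) * nrm ?h"
          using fH sH g by (intro Cauchy_Schwarz) auto
        also have "\<dots> \<le> nrm (f - s) * (nrm g + 1)"
          using defect_pow_nrm_le[OF g, of N] fH sH by (intro mult_left_mono) auto
        also have "\<dots> \<le> e / 2" using s(2) pos_less_divide_eq[OF pos, of "nrm (f - s)" "e / 2"] by simp
        finally have "cmod (ip (f - s) ?h) \<le> e / 2" .
        moreover have "cmod (ip f ?h) \<le> cmod (ip (f - s) ?h) + cmod (ip s ?h)"
          using norm_triangle_ineq[of "ip (f - s) ?h" "ip s ?h"] fH sH g by (simp add: ip_diff_left)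
        ultimately show ?thesis using N0[OF that] by linarith
      qed
      then show ?thesis by blast
    qed
    then show ?thesis using fH by (simp add: Z_def LIMSEQ_iff)
  qed
  ultimately have "closed_subspace Z"
    unfolding closed_subspace_def using cl_superset[OF ZH] ZH by blast
  then have "cyclic \<eta> \<subseteq> Z"
    unfolding cyclic_def using orbit by (intro cl_span_minimal) auto
  then show ?thesis using f by (auto simp: Z_def)
qed

lemma moment_limit:
  assumes f: "f \<in> cyclic \<eta>"
  shows "(\<lambda>N. moment \<eta> N f) \<longlonglongrightarrow> 0"
proof -
  have fH: "f \<in> H" using f cl_subset_H by (auto simp: cyclic_def)
  have "(\<lambda>N. Re (ip f ((defect \<eta> ^^ N) f))) \<longlonglongrightarrow> Re 0"
    by (rule tendsto_Re[OF defect_pow_weak_limit[OF f fH]])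
  then show ?thesis by (simp add: moment_def defect_pow_adjoint[OF fH fH])
qed

lemma psum_in_cyclic: "psum \<eta> I \<eta> \<in> cyclic \<eta>"
proof -
  have sub: "subspace (cyclic \<eta>)" using closed_subspace_cyclic[OF \<eta>] by (simp add: closed_subspace_def)
  have "(defect \<eta> ^^ k) \<eta> \<in> cyclic \<eta>" for k
  proof (induction k)
    case (Suc k)
    have "frame_op (\<lambda>\<gamma>. U \<gamma> \<eta>) ((defect \<eta> ^^ k) \<eta>) \<in> cyclic \<eta>"
      using frame_op_cl[OF bessel] \<eta> by (simp add: cyclic_def)
    then show ?case
      using Suc by (simp add: defect_def[of \<eta> "(defect \<eta> ^^ k) \<eta>"] subspace_diff[OF sub])
  qed (simp add: self_in_cyclic \<eta>)
  then show ?thesis unfolding psum_def by (intro subspace_sum[OF sub] subspace_scale[OF sub])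
qed

text \<open>By \<open>bform_increment\<close>, squared increments are bounded by increments of the
  squared norms, which never exceed 1.\<close>

lemma psum_limit:
  obtains \<psi> where "\<psi> \<in> H" "(\<lambda>N. nrm (psum \<eta> {..N} \<eta> - \<psi>)) \<longlonglongrightarrow> 0"
proof (rule complete_monotone[of "\<lambda>N. psum \<eta> {..N} \<eta>" "\<lambda>N. (nrm (psum \<eta> {..N} \<eta>))\<^sup>2" 1])
  show "psum \<eta> {..n} \<eta> \<in> H" for n using \<eta> by simp
  show "(nrm (psum \<eta> {..n} \<eta>))\<^sup>2 \<le> 1" for n
    using psum_nrm_le \<eta> by (simp add: power_le_one)
  show "(nrm (psum \<eta> {..m} \<eta> - psum \<eta> {..n} \<eta>))\<^sup>2 \<le> (nrm (psum \<eta> {..m} \<eta>))\<^sup>2 - (nrm (psum \<eta> {..n} \<eta>))\<^sup>2"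
    if "n \<le> m" for m n
  proof -
    have "{..m} - {..n} = {n<..m}" by auto
    then have "psum \<eta> {..m} \<eta> - psum \<eta> {..n} \<eta> = psum \<eta> {n<..m} \<eta>"
      unfolding psum_def using that by (subst sum_diff[symmetric]) auto
    then show ?thesis
      using that \<eta> by (simp add: psum_nrm bform_increment moment_nonneg)
  qed
qed (use that in blast)

end

section \<open>The limit of the binomial series is a Parseval generator\<close>

definition parseval_on :: "'v set \<Rightarrow> 'v \<Rightarrow> bool" where
  "parseval_on K \<psi> \<longleftrightarrow> (\<forall>f\<in>K. ((\<lambda>\<gamma>. (cmod (ip f (U \<gamma> \<psi>)))\<^sup>2) has_sum (nrm f)\<^sup>2) UNIV)"

text \<open>The upper half survives the limit in every finite sum. The lower half needs uniform
  control: the orbit coefficients of \<open>\<psi>\<close> and of a partial sum differ in square sum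
  by at most one moment, and moments vanish in the limit exactly because f lies in the cyclic space
  of \<open>\<eta>\<close>.\<close>

proposition parseval_generator:
  assumes \<eta>: "\<eta> \<in> H" and bessel: "bessel (\<lambda>\<gamma>. U \<gamma> \<eta>)"
  obtains \<psi> where "\<psi> \<in> cyclic \<eta>" "parseval_on (cyclic \<eta>) \<psi>"
proof -
  obtain \<psi> where \<psi>: "\<psi> \<in> H" and lim: "(\<lambda>N. nrm (psum \<eta> {..N} \<eta> - \<psi>)) \<longlonglongrightarrow> 0"
    using psum_limit[OF \<eta> bessel] .
  let ?p = "\<lambda>N. psum \<eta> {..N} \<eta>"
  have pH: "psum \<eta> I \<eta> \<in> H" for I using psum_H[OF \<eta> bessel \<eta>] .
  \<comment> \<open>The shift h is 0 for the Bessel bound of \<open>\<psi>\<close> and a fixed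
    partial sum for the error estimate.\<close>
  have Ulim: "(\<lambda>N. cmod (ip f (U \<gamma> (?p N - h)))) \<longlonglongrightarrow> cmod (ip f (U \<gamma> (\<psi> - h)))"
    if "f \<in> H" "h \<in> H" for f \<gamma> h
  proof (intro tendsto_norm tendsto_ip_right)
    have "nrm (U \<gamma> (?p N - h) - U \<gamma> (\<psi> - h)) = nrm (?p N - \<psi>)" for N
      using pH \<psi> that by (simp flip: U_diff)
    then show "(\<lambda>N. nrm (U \<gamma> (?p N - h) - U \<gamma> (\<psi> - h))) \<longlonglongrightarrow> 0" using lim by simp
  qed (use pH \<psi> that in auto)
  have bd: "(\<Sum>\<gamma>\<in>F. (cmod (ip f (U \<gamma> \<psi>)))\<^sup>2) \<le> (nrm f)\<^sup>2" if f: "f \<in> H" and F: "finite F" for f F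
  proof (rule LIMSEQ_le_const2)
    have "(\<lambda>N. \<Sum>\<gamma>\<in>F. (cmod (ip f (U \<gamma> (?p N - 0))))\<^sup>2) \<longlonglongrightarrow> (\<Sum>\<gamma>\<in>F. (cmod (ip f (U \<gamma> (\<psi> - 0))))\<^sup>2)"
      using f by (intro tendsto_sum tendsto_power Ulim) auto
    then show "(\<lambda>N. \<Sum>\<gamma>\<in>F. (cmod (ip f (U \<gamma> (?p N))))\<^sup>2) \<longlonglongrightarrow> (\<Sum>\<gamma>\<in>F. (cmod (ip f (U \<gamma> \<psi>)))\<^sup>2)"
      by simp
    have "(\<Sum>\<gamma>\<in>F. (cmod (ip f (U \<gamma> (?p N))))\<^sup>2) \<le> (nrm f)\<^sup>2" for N
      using finite_sum_le_has_sum[OF psum_orbit_has_sum[OF \<eta> bessel f] F]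
        psum_orbit_bounds(2)[OF \<eta> bessel f, of N] by (meson order_trans subset_UNIV zero_le_power2)
    then show "\<exists>N0. \<forall>N\<ge>N0. (\<Sum>\<gamma>\<in>F. (cmod (ip f (U \<gamma> (?p N))))\<^sup>2) \<le> (nrm f)\<^sup>2" by blast
  qed
  \<comment> \<open>Limit M to infinity of the bound on the block of exponents between N and M,
    which does not depend on M.\<close>
  have err: "(\<Sum>\<gamma>\<in>F. (cmod (ip f (U \<gamma> (\<psi> - ?p N))))\<^sup>2) \<le> moment \<eta> (Suc N) f"
    if f: "f \<in> H" and F: "finite F" for f F N
  proof (rule LIMSEQ_le_const2)
    show "(\<lambda>M. \<Sum>\<gamma>\<in>F. (cmod (ip f (U \<gamma> (?p M - ?p N))))\<^sup>2) \<longlonglongrightarrow> (\<Sum>\<gamma>\<in>F. (cmod (ip f (U \<gamma> (\<psi> - ?p N))))\<^sup>2)"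
      using f pH by (intro tendsto_sum tendsto_power Ulim) auto
    have "(\<Sum>\<gamma>\<in>F. (cmod (ip f (U \<gamma> (?p M - ?p N))))\<^sup>2) \<le> moment \<eta> (Suc N) f" if "M \<ge> N" for M
    proof -
      have "{..M} - {..N} = {N<..M}" by auto
      then have "?p M - ?p N = psum \<eta> {N<..M} \<eta>"
        unfolding psum_def using that by (subst sum_diff[symmetric]) auto
      then show ?thesis
        using finite_sum_le_has_sum[OF psum_orbit_has_sum[OF \<eta> bessel f, of "{N<..M}"] F]
          psum_orbit_bounds(3)[OF \<eta> bessel f that] by simp
    qed
    then show "\<exists>M0. \<forall>M\<ge>M0. (\<Sum>\<gamma>\<in>F. (cmod (ip f (U \<gamma> (?p M - ?p N))))\<^sup>2) \<le> moment \<eta> (Suc N) f" by blast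
  qed
  have "parseval_on (cyclic \<eta>) \<psi>"
    unfolding parseval_on_def
  proof
    fix f assume f: "f \<in> cyclic \<eta>"
    then have fH: "f \<in> H" using cl_subset_H by (auto simp: cyclic_def)
    let ?a = "\<lambda>\<gamma>. cmod (ip f (U \<gamma> \<psi>))"
    have "(\<lambda>\<gamma>. (?a \<gamma>)\<^sup>2) summable_on UNIV"
      using bd[OF fH] by (intro nonneg_bdd_above_summable_on bdd_aboveI2[where M = "(nrm f)\<^sup>2"]) auto
    then obtain B where B: "((\<lambda>\<gamma>. (?a \<gamma>)\<^sup>2) has_sum B) UNIV" by (auto simp: summable_on_def)
    have "B \<le> (nrm f)\<^sup>2"
      using B by (rule has_sum_le_finite_sums) (use bd[OF fH] in auto)
    moreover have "(nrm f)\<^sup>2 \<le> B"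
    proof -
      have *: "sqrt ((nrm f)\<^sup>2 - moment \<eta> (Suc N) f) \<le> sqrt B + sqrt (moment \<eta> (Suc N) f)" for N
      proof -
        let ?Q = "bform {..N} (\<lambda>k. moment \<eta> k f - moment \<eta> (Suc k) f)"
        \<comment> \<open>Minkowski's inequality on finite index sets: the coefficients against the
          orbit of the partial sum are those of \<open>\<psi>\<close> plus an error controlled by
          \<open>err\<close>.\<close>
        have "?Q \<le> (sqrt B + sqrt (moment \<eta> (Suc N) f))\<^sup>2"
        proof (rule has_sum_le_finite_sums[OF psum_orbit_has_sum[OF \<eta> bessel fH]])
          fix F :: "'g set" assume F: "finite F"
          have "cmod (ip f (U \<gamma> (?p N))) \<le> ?a \<gamma> + cmod (ip f (U \<gamma> (\<psi> - ?p N)))" for \<gamma>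
          proof -
            have "ip f (U \<gamma> (?p N)) = ip f (U \<gamma> \<psi>) - ip f (U \<gamma> (\<psi> - ?p N))"
              using fH \<psi> pH by (simp add: U_diff ip_diff_right)
            then show ?thesis by (simp add: norm_triangle_ineq4)
          qed
          then have "L2_set (\<lambda>\<gamma>. cmod (ip f (U \<gamma> (?p N)))) F
              \<le> L2_set (\<lambda>\<gamma>. ?a \<gamma> + cmod (ip f (U \<gamma> (\<psi> - ?p N)))) F"
            by (intro L2_set_mono) auto
          also have "\<dots> \<le> L2_set ?a F + L2_set (\<lambda>\<gamma>. cmod (ip f (U \<gamma> (\<psi> - ?p N)))) F"
            by (rule L2_set_triangle_ineq)
          also have "\<dots> \<le> sqrt B + sqrt (moment \<eta> (Suc N) f)"
            unfolding L2_set_def using err[OF fH F] finite_sum_le_has_sum[OF B F]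
            by (intro add_mono real_sqrt_le_mono) auto
          finally have "(L2_set (\<lambda>\<gamma>. cmod (ip f (U \<gamma> (?p N)))) F)\<^sup>2 \<le> (sqrt B + sqrt (moment \<eta> (Suc N) f))\<^sup>2"
            by (intro power_mono) auto
          then show "(\<Sum>\<gamma>\<in>F. (cmod (ip f (U \<gamma> (?p N))))\<^sup>2) \<le> (sqrt B + sqrt (moment \<eta> (Suc N) f))\<^sup>2"
            by (simp add: L2_set_def sum_nonneg)
        qed
        then have "(nrm f)\<^sup>2 - moment \<eta> (Suc N) f \<le> (sqrt B + sqrt (moment \<eta> (Suc N) f))\<^sup>2"
          using psum_orbit_bounds(1)[OF \<eta> bessel fH, of N] by linarith
        moreover have "0 \<le> B" using B by (rule has_sum_nonneg) auto
        ultimately show ?thesis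
          using moment_nonneg[OF \<eta> bessel fH] by (intro real_le_lsqrt) auto
      qed
      have m: "(\<lambda>N. moment \<eta> (Suc N) f) \<longlonglongrightarrow> 0"
        by (rule LIMSEQ_Suc[OF moment_limit[OF \<eta> bessel f]])
      have "sqrt ((nrm f)\<^sup>2 - 0) \<le> sqrt B + sqrt 0"
        by (rule LIMSEQ_le[OF tendsto_real_sqrt[OF tendsto_diff[OF tendsto_const m]]
              tendsto_add[OF tendsto_const tendsto_real_sqrt[OF m]]]) (use * in blast)
      then show ?thesis by (simp only: diff_zero real_sqrt_zero add_0_right real_sqrt_le_iff)
    qed
    ultimately show "((\<lambda>\<gamma>. (?a \<gamma>)\<^sup>2) has_sum (nrm f)\<^sup>2) UNIV" using B by simp
  qed
  moreover have "\<psi> \<in> cyclic \<eta>"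
    using closed_subspace_limit[OF closed_subspace_cyclic[OF \<eta>] psum_in_cyclic[OF \<eta> bessel] \<psi> lim] .
  ultimately show ?thesis using that by blast
qed

end

section \<open>Decomposition of invariant subspaces\<close>

context semi_hilbert
begin

lemma closed_subspace_orthogonal:
  assumes A: "A \<subseteq> H"
  shows "closed_subspace {f \<in> H. \<forall>a\<in>A. ip f a = 0}" (is "closed_subspace ?P")
  unfolding closed_subspace_def
proof (intro conjI)
  show P: "?P \<subseteq> H" by auto
  show "subspace ?P"
    using A by (intro subspaceI) (auto simp: ip_add_left ip_scale_left subset_iff)
  have "ip f a = 0" if f: "f \<in> cl ?P" and a: "a \<in> A" for f a
  proof (rule ccontr)
    assume ne: "ip f a \<noteq> 0"
    have fH: "f \<in> H" and aH: "a \<in> H" using f a A cl_subset_H by auto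
    have pos: "0 < nrm a + 1" using aH by (simp add: add_nonneg_pos)
    then have "0 < cmod (ip f a) / (nrm a + 1)" using ne by simp
    then obtain g where g: "g \<in> H" "ip g a = 0" "nrm (f - g) < cmod (ip f a) / (nrm a + 1)"
      using f a unfolding cl_def by blast
    have "cmod (ip f a) = cmod (ip (f - g) a)"
      using g fH aH by (simp add: ip_diff_left)
    also have "\<dots> \<le> nrm (f - g) * nrm a"
      using g fH aH by (intro Cauchy_Schwarz) auto
    also have "\<dots> \<le> nrm (f - g) * (nrm a + 1)"
      using g fH by (intro mult_left_mono) auto
    also have "\<dots> < cmod (ip f a)"
      using g(3) pos_less_divide_eq[OF pos] by blast
    finally show False by simp
  qed
  then show "cl ?P = ?P" using cl_superset[OF P] cl_subset_H[of ?P] by blast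
qed

lemma closed_subspace_Int:
  assumes "closed_subspace K" "closed_subspace L"
  shows "closed_subspace (K \<inter> L)"
proof -
  have "cl (K \<inter> L) \<subseteq> K \<inter> L"
    using cl_mono[of "K \<inter> L" K] cl_mono[of "K \<inter> L" L] assms
    unfolding closed_subspace_def by blast
  moreover have "K \<inter> L \<subseteq> cl (K \<inter> L)"
    using assms by (intro cl_superset) (auto simp: closed_subspace_def)
  ultimately show ?thesis
    using assms unfolding closed_subspace_def by (auto intro: subspace_inter)
qed

lemma orthogonal_cl_span:
  assumes A: "A \<subseteq> H" and f: "f \<in> H" "\<And>a. a \<in> A \<Longrightarrow> ip a f = 0" and g: "g \<in> cl (span A)"
  shows "ip g f = 0"
proof -
  have "cl (span A) \<subseteq> {g \<in> H. \<forall>a\<in>{f}. ip g a = 0}"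
    using A f by (intro cl_span_minimal closed_subspace_orthogonal) auto
  then show ?thesis using g by auto
qed

end

context unitary_rep
begin

lemma orthogonal_cyclic:
  assumes \<psi>: "\<psi> \<in> H" and f: "f \<in> H" "\<And>\<gamma>. ip f (U \<gamma> \<psi>) = 0" and g: "g \<in> cyclic \<psi>"
  shows "ip f g = 0"
proof -
  have gH: "g \<in> H" using g cl_subset_H by (auto simp: cyclic_def)
  have "ip (U \<gamma> \<psi>) f = 0" for \<gamma>
    using ip_cnj[of f "U \<gamma> \<psi>"] f \<psi> by simp
  then have "ip g f = 0"
    using orthogonal_cl_span[OF orbit_subset_H[OF \<psi>] f(1) _ g[unfolded cyclic_def]] by auto
  then show ?thesis using ip_cnj[OF gH f(1)] by simp
qed

text \<open>The part of \<open>\<eta>\<close> orthogonal to the cyclic space of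
  \<open>\<psi>\<close> still lies in that of \<open>\<eta>\<close> and has zero coefficients, so
  Parseval makes it null. This is why Parseval is first established on the cyclic space of
  \<open>\<eta>\<close>.\<close>

lemma parseval_cyclic_generator:
  assumes \<eta>: "\<eta> \<in> H" and \<psi>: "\<psi> \<in> cyclic \<eta>" and P: "parseval_on (cyclic \<eta>) \<psi>"
  shows "\<eta> \<in> cyclic \<psi>"
proof -
  have \<psi>H: "\<psi> \<in> H" using \<psi> cl_subset_H by (auto simp: cyclic_def)
  obtain p where p: "p \<in> cyclic \<psi>" "\<And>k. k \<in> cyclic \<psi> \<Longrightarrow> ip (\<eta> - p) k = 0"
    using projection[OF closed_subspace_cyclic[OF \<psi>H] \<eta>] by blast
  have pH: "p \<in> H" using p cl_subset_H by (auto simp: cyclic_def)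
  have "p \<in> cyclic \<eta>" using cyclic_minimal[OF invariant_cyclic[OF \<eta>] \<psi>] p by blast
  then have "\<eta> - p \<in> cyclic \<eta>"
    using closed_subspace_cyclic[OF \<eta>] self_in_cyclic[OF \<eta>]
    by (auto simp: closed_subspace_def intro: subspace_diff)
  then have "((\<lambda>\<gamma>. (cmod (ip (\<eta> - p) (U \<gamma> \<psi>)))\<^sup>2) has_sum (nrm (\<eta> - p))\<^sup>2) UNIV"
    using P by (simp add: parseval_on_def)
  then have "((\<lambda>_. 0) has_sum (nrm (\<eta> - p))\<^sup>2) (UNIV :: 'g set)"
    using p(2)[OF orbit_in_cyclic[OF \<psi>H]] by simp
  then have "(nrm (\<eta> - p))\<^sup>2 = 0"
    by (rule has_sum_unique[OF _ has_sum_0]) simp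
  then have "nrm (p - \<eta>) = 0" using nrm_minus_commute[OF \<eta> pH] by simp
  then show ?thesis
    using closed_subspace_null[OF closed_subspace_cyclic[OF \<psi>H] p(1) \<eta>] by blast
qed

text \<open>Since W is invariant, so is its orthogonal complement; hence vectors of W have the same
  coefficients against the orbits of \<open>\<phi>\<close> and of its projection
  \<open>\<eta>\<close>. The last conclusion transports totality of the original vectors to the
  constructed generators.\<close>

lemma parseval_generator_of_projection:
  assumes W: "invariant W" and \<phi>: "\<phi> \<in> H" and bessel: "bessel (\<lambda>\<gamma>. U \<gamma> \<phi>)"
  obtains \<psi> where "\<psi> \<in> W" "parseval_on (cyclic \<psi>) \<psi>"
    "\<And>h \<gamma>. h \<in> W \<Longrightarrow> (\<And>\<delta>. ip h (U \<delta> \<psi>) = 0) \<Longrightarrow> ip h (U \<gamma> \<phi>) = 0"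
proof -
  have Wc: "closed_subspace W" and WU: "\<And>f \<gamma>. f \<in> W \<Longrightarrow> U \<gamma> f \<in> W" and WH: "W \<subseteq> H"
    using W by (auto simp: invariant_def closed_subspace_def)
  obtain \<eta> where \<eta>: "\<eta> \<in> W" "\<And>k. k \<in> W \<Longrightarrow> ip (\<phi> - \<eta>) k = 0"
    using projection[OF Wc \<phi>] by blast
  have \<eta>H: "\<eta> \<in> H" using \<eta> WH by blast
  have same: "ip k (U \<gamma> \<phi>) = ip k (U \<gamma> \<eta>)" if k: "k \<in> W" for k \<gamma>
  proof -
    have kH: "k \<in> H" using k WH by blast
    have "ip (U \<gamma> (\<phi> - \<eta>)) k = 0"
      using U_adjoint[of "\<phi> - \<eta>" k \<gamma>] \<eta>(2)[OF WU[OF k]] \<phi> \<eta>H kH by simp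
    then have "ip k (U \<gamma> (\<phi> - \<eta>)) = 0"
      using ip_cnj[of "U \<gamma> (\<phi> - \<eta>)" k] \<phi> \<eta>H kH by simp
    then show ?thesis using \<phi> \<eta>H kH by (simp add: U_diff ip_diff_right)
  qed
  have "bessel (\<lambda>\<gamma>. U \<gamma> \<eta>)"
    unfolding bessel_def
  proof (intro conjI ballI allI impI)
    show "range (\<lambda>\<gamma>. U \<gamma> \<eta>) \<subseteq> H" using \<eta>H by auto
    fix f and F :: "'g set"
    assume f: "f \<in> H" and F: "finite F"
    \<comment> \<open>The Bessel bound passes from \<open>\<phi>\<close> to \<open>\<eta>\<close> by
      projecting f as well: the orbit of \<open>\<eta>\<close> lies in W, so only the component p of
      f counts.\<close>
    obtain p where p: "p \<in> W" "\<And>k. k \<in> W \<Longrightarrow> ip (f - p) k = 0" using projection[OF Wc f] by blast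
    have pH: "p \<in> H" using p WH by blast
    have "ip f (U \<gamma> \<eta>) = ip p (U \<gamma> \<phi>)" for \<gamma>
      using p(2)[OF WU[OF \<eta>(1)], of \<gamma>] same[OF p(1)] f pH \<eta>H by (simp add: ip_diff_left)
    then have "(\<Sum>\<gamma>\<in>F. (cmod (ip f (U \<gamma> \<eta>)))\<^sup>2) \<le> (nrm p)\<^sup>2"
      using bessel pH F by (simp add: bessel_def)
    also have "\<dots> \<le> (nrm f)\<^sup>2"
      using nrm_add_sq[of "f - p" p] p(2)[OF p(1)] f pH by simp
    finally show "(\<Sum>\<gamma>\<in>F. (cmod (ip f (U \<gamma> \<eta>)))\<^sup>2) \<le> (nrm f)\<^sup>2" .
  qed
  then obtain \<psi> where \<psi>: "\<psi> \<in> cyclic \<eta>" "parseval_on (cyclic \<eta>) \<psi>"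
    using parseval_generator[OF \<eta>H] by blast
  have \<psi>H: "\<psi> \<in> H" using \<psi> cl_subset_H by (auto simp: cyclic_def)
  show ?thesis
  proof (rule that)
    show "\<psi> \<in> W" using cyclic_minimal[OF W \<eta>(1)] \<psi> by blast
    show "parseval_on (cyclic \<psi>) \<psi>"
      using \<psi>(2) cyclic_minimal[OF invariant_cyclic[OF \<eta>H] \<psi>(1)] unfolding parseval_on_def by blast
    fix h \<gamma>
    assume h: "h \<in> W" and orth: "\<And>\<delta>. ip h (U \<delta> \<psi>) = 0"
    have "U \<gamma> \<eta> \<in> cyclic \<psi>"
      using parseval_cyclic_generator[OF \<eta>H \<psi>] invariant_cyclic[OF \<psi>H] by (auto simp: invariant_def)
    then have "ip h (U \<gamma> \<eta>) = 0"
      using orthogonal_cyclic[OF \<psi>H _ orth] h WH by blast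
    then show "ip h (U \<gamma> \<phi>) = 0" using same[OF h] by simp
  qed
qed

lemma invariant_orthogonal:
  assumes V: "invariant V" and A: "A \<subseteq> H"
  shows "invariant {f \<in> V. \<forall>a\<in>A. \<forall>\<gamma>. ip f (U \<gamma> a) = 0}" (is "invariant ?W")
proof -
  have VH: "V \<subseteq> H" using V by (auto simp: invariant_def closed_subspace_def)
  let ?O = "\<Union>a\<in>A. range (\<lambda>\<gamma>. U \<gamma> a)"
  have "?O \<subseteq> H" using A by auto
  then have "closed_subspace (V \<inter> {f \<in> H. \<forall>b\<in>?O. ip f b = 0})"
    using V by (intro closed_subspace_Int closed_subspace_orthogonal) (auto simp: invariant_def)
  moreover have "V \<inter> {f \<in> H. \<forall>b\<in>?O. ip f b = 0} = ?W"
    using VH by auto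
  ultimately have "closed_subspace ?W" by simp
  moreover have "ip (U \<delta> f) (U \<gamma> a) = 0" if "f \<in> ?W" "a \<in> A" for f a \<gamma> \<delta>
  proof -
    have "f \<in> H" "a \<in> H" using that A VH by auto
    then have "ip (U \<delta> f) (U \<gamma> a) = ip f (U (- \<delta> + \<gamma>) a)"
      by (simp add: U_adjoint U_U_right)
    then show ?thesis using that by simp
  qed
  ultimately show ?thesis using V by (auto simp: invariant_def)
qed

theorem parseval_decomposition:
  fixes \<phi> :: "nat \<Rightarrow> 'v"
  assumes V: "invariant V" and \<phi>: "\<And>n. \<phi> n \<in> H" and bessel: "\<And>n. bessel (\<lambda>\<gamma>. U \<gamma> (\<phi> n))"
    and total: "\<And>h. h \<in> H \<Longrightarrow> (\<And>n \<gamma>. ip h (U \<gamma> (\<phi> n)) = 0) \<Longrightarrow> nrm h = 0"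
  obtains \<psi> :: "nat \<Rightarrow> 'v" where "\<And>n. \<psi> n \<in> V" "\<And>n. parseval_on (cyclic (\<psi> n)) (\<psi> n)"
    "\<And>m n f g. m \<noteq> n \<Longrightarrow> f \<in> cyclic (\<psi> m) \<Longrightarrow> g \<in> cyclic (\<psi> n) \<Longrightarrow> ip f g = 0"
    "V = cl (span (\<Union>n. cyclic (\<psi> n)))"
proof -
  have Vc: "closed_subspace V" and VH: "V \<subseteq> H"
    using V by (auto simp: invariant_def closed_subspace_def)
  \<comment> \<open>\<open>W f n\<close> reads only the values of f below n, as well-founded choice
    requires of \<open>P\<close>.\<close>
  define W where "W f n = {v \<in> V. \<forall>a\<in>f ` {..<n::nat}. \<forall>\<gamma>. ip v (U \<gamma> a) = 0}" for f n
  \<comment> \<open>The last clause says that \<open>\<psi> n\<close> exhausts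
    \<open>\<phi> n\<close>: inside the current complement, whatever is orthogonal to the orbit of
    the former is orthogonal to the orbit of the latter.\<close>
  define P where "P f n \<psi> \<longleftrightarrow> \<psi> \<in> W f n \<and> parseval_on (cyclic \<psi>) \<psi> \<and>
    (\<forall>h\<in>W f n. (\<forall>\<gamma>. ip h (U \<gamma> \<psi>) = 0) \<longrightarrow> (\<forall>\<gamma>. ip h (U \<gamma> (\<phi> n)) = 0))" for f n \<psi>
  have "\<exists>\<psi>. \<forall>n. P \<psi> n (\<psi> n)"
  proof (rule dependent_wf_choice[of less_than])
    fix f g :: "nat \<Rightarrow> 'v" and n r
    assume "\<And>z. (z, n) \<in> less_than \<Longrightarrow> f z = g z"
    then have "f ` {..<n} = g ` {..<n}" by auto
    then have "W f n = W g n" unfolding W_def by simp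
    then show "P f n r = P g n r" unfolding P_def by simp
  next
    fix n and f :: "nat \<Rightarrow> 'v"
    assume "\<And>y. (y, n) \<in> less_than \<Longrightarrow> P f y (f y)"
    then have "f ` {..<n} \<subseteq> H" using VH by (auto simp: P_def W_def)
    then have "invariant (W f n)" unfolding W_def by (rule invariant_orthogonal[OF V])
    then show "\<exists>r. P f n r"
      using parseval_generator_of_projection[OF _ \<phi> bessel] unfolding P_def by metis
  qed simp
  then obtain \<psi> where P: "\<And>n. P \<psi> n (\<psi> n)" by blast
  have \<psi>V: "\<psi> n \<in> V" for n using P[of n] by (simp add: P_def W_def)
  have \<psi>H: "\<psi> n \<in> H" for n using \<psi>V VH by blast
  have cyV: "cyclic (\<psi> n) \<subseteq> V" for n using cyclic_minimal[OF V \<psi>V] .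
  have cyH: "cyclic (\<psi> n) \<subseteq> H" for n using cyV VH by blast
  have lt: "ip f g = 0" if "m < n" "f \<in> cyclic (\<psi> n)" "g \<in> cyclic (\<psi> m)" for m n f g
  proof -
    have "invariant (W \<psi> n)" unfolding W_def using \<psi>H by (intro invariant_orthogonal[OF V]) auto
    then have "cyclic (\<psi> n) \<subseteq> W \<psi> n" using P[of n] by (intro cyclic_minimal) (auto simp: P_def)
    then have "ip f (U \<gamma> (\<psi> m)) = 0" for \<gamma> using that by (auto simp: W_def)
    then show ?thesis using orthogonal_cyclic[OF \<psi>H] that cyH by blast
  qed
  have orth: "ip f g = 0" if "m \<noteq> n" "f \<in> cyclic (\<psi> m)" "g \<in> cyclic (\<psi> n)" for m n f g
  proof (cases "n < m")
    case True
    then show ?thesis using lt that by blast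
  next
    case False
    then have "ip g f = 0" using lt[of m n g f] that by simp
    then show ?thesis using ip_cnj[of g f] that cyH by fastforce
  qed
  have UH: "(\<Union>n. cyclic (\<psi> n)) \<subseteq> H" using cyH by blast
  let ?Y = "cl (span (\<Union>n. cyclic (\<psi> n)))"
  have YV: "?Y \<subseteq> V" using cyV by (intro cl_span_minimal[OF _ Vc]) blast
  have "V \<subseteq> ?Y"
  proof
    fix f assume f: "f \<in> V"
    have fH: "f \<in> H" using f VH by blast
    obtain p where p: "p \<in> ?Y" "\<And>k. k \<in> ?Y \<Longrightarrow> ip (f - p) k = 0"
      using projection[OF closed_subspace_cl_span[OF UH] fH] by blast
    have pH: "p \<in> H" using p cl_subset_H by blast
    have hV: "f - p \<in> V"
      using f p YV Vc by (auto simp: closed_subspace_def intro: subspace_diff)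
    have z: "ip (f - p) (U \<gamma> (\<psi> n)) = 0" for \<gamma> n
      using p(2) cl_span_superset[OF UH] orbit_in_cyclic[OF \<psi>H] by blast
    \<comment> \<open>Being orthogonal to all chosen orbits, the remainder lies in every complement,
      so the last clause of \<open>P\<close> applies for all n at once.\<close>
    then have "f - p \<in> W \<psi> n" for n using hV by (auto simp: W_def)
    then have "ip (f - p) (U \<gamma> (\<phi> n)) = 0" for \<gamma> n using P[of n] z unfolding P_def by blast
    then have "nrm (f - p) = 0" using total fH pH by simp
    then have "nrm (p - f) = 0" using nrm_minus_commute[OF fH pH] by simp
    then show "f \<in> ?Y" using closed_subspace_null[OF closed_subspace_cl_span[OF UH] p(1) fH] by blast
  qed
  then have "V = ?Y" using YV by blast
  moreover have "parseval_on (cyclic (\<psi> n)) (\<psi> n)" for n using P[of n] by (simp add: P_def)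
  ultimately show ?thesis using that \<psi>V orth by blast
qed

end

section \<open>Completeness of $L^2$\<close>

lemma measurable_cnj [measurable]: "cnj \<in> borel_measurable borel"
  by (intro borel_measurable_continuous_onI continuous_intros)

lemma L2_I: "f \<in> borel_measurable M \<Longrightarrow> integrable M (\<lambda>x. (cmod (f x))\<^sup>2) \<Longrightarrow> f \<in> L2 M"
  by (simp add: L2_def)

lemma L2_measurable: "f \<in> L2 M \<Longrightarrow> f \<in> borel_measurable M"
  by (simp add: L2_def)

lemma L2_integrable: "f \<in> L2 M \<Longrightarrow> integrable M (\<lambda>x. (cmod (f x))\<^sup>2)"
  by (simp add: L2_def)

lemma L2_mult_integrable:
  assumes f: "f \<in> L2 M" and g: "g \<in> L2 M"
  shows "integrable M (\<lambda>x. f x * cnj (g x))"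
proof (rule Bochner_Integration.integrable_bound)
  show "integrable M (\<lambda>x. (cmod (f x))\<^sup>2 + (cmod (g x))\<^sup>2)"
    using f g by (intro Bochner_Integration.integrable_add L2_integrable)
  have [measurable]: "f \<in> borel_measurable M" "g \<in> borel_measurable M"
    using f g by (auto simp: L2_measurable)
  show "(\<lambda>x. f x * cnj (g x)) \<in> borel_measurable M" by measurable
  have "norm (a * cnj b) \<le> norm ((cmod a)\<^sup>2 + (cmod b)\<^sup>2)" for a b :: complex
  proof -
    have "2 * (cmod a * cmod b) \<le> (cmod a)\<^sup>2 + (cmod b)\<^sup>2"
      using sum_squares_bound[of "cmod a" "cmod b"] by simp
    moreover have "0 \<le> cmod a * cmod b" by simp
    ultimately have "cmod a * cmod b \<le> (cmod a)\<^sup>2 + (cmod b)\<^sup>2" by linarith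
    then show ?thesis by (simp add: norm_mult)
  qed
  then show "AE x in M. norm (f x * cnj (g x)) \<le> norm ((cmod (f x))\<^sup>2 + (cmod (g x))\<^sup>2)"
    by simp
qed

lemma L2_inner_self: "L2_inner M f f = of_real ((L2_norm M f)\<^sup>2)"
proof -
  have "L2_inner M f f = of_real (LINT x|M. (cmod (f x))\<^sup>2)"
    unfolding L2_inner_def complex_norm_square[symmetric] of_real_power[symmetric]
    by (rule integral_complex_of_real)
  moreover have "0 \<le> (LINT x|M. (cmod (f x))\<^sup>2)" by simp
  ultimately show ?thesis by (simp add: L2_norm_def)
qed

lemma L2_norm_eq: "L2_norm M f = sqrt (Re (L2_inner M f f))"
  unfolding L2_inner_self by (simp add: L2_norm_def)

lemma subspace_L2: "cfun.subspace (L2 M)"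
proof (rule cfun.subspaceI)
  show "0 \<in> L2 M" by (simp add: L2_def zero_fun_def)
  show "f + g \<in> L2 M" if f: "f \<in> L2 M" and g: "g \<in> L2 M" for f g
  proof (rule L2_I)
    have [measurable]: "f \<in> borel_measurable M" "g \<in> borel_measurable M"
      using f g by (auto simp: L2_measurable)
    show fg: "f + g \<in> borel_measurable M" by (simp add: plus_fun_def)
    show "integrable M (\<lambda>x. (cmod ((f + g) x))\<^sup>2)"
    proof (rule Bochner_Integration.integrable_bound)
      show "integrable M (\<lambda>x. 2 * (cmod (f x))\<^sup>2 + 2 * (cmod (g x))\<^sup>2)"
        by (intro Bochner_Integration.integrable_add integrable_mult_right L2_integrable f g)
      have "norm ((cmod (a + b))\<^sup>2) \<le> norm (2 * (cmod a)\<^sup>2 + 2 * (cmod b)\<^sup>2)" for a b :: complex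
      proof -
        have "(cmod (a + b))\<^sup>2 \<le> (cmod a + cmod b)\<^sup>2"
          by (intro power_mono norm_triangle_ineq) auto
        then show ?thesis using sum_squares_bound[of "cmod a" "cmod b"] by (simp add: power2_sum)
      qed
      then show "AE x in M. norm ((cmod ((f + g) x))\<^sup>2) \<le> norm (2 * (cmod (f x))\<^sup>2 + 2 * (cmod (g x))\<^sup>2)"
        by (simp add: plus_fun_def)
    qed (simp add: plus_fun_def)
  qed
  show "cfun_scale c f \<in> L2 M" if f: "f \<in> L2 M" for c f
    using f by (auto simp: L2_def cfun_scale_def norm_mult power_mult_distrib)
qed

text \<open>Fatou's lemma along the subsequence bounds the integral of |X n - f|^2 by e^2. Square
  integrability is thus obtained for X N - f first, and for f by subtraction.\<close>

lemma L2_norm_tendsto_of_AE: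
  assumes X: "\<And>n. X n \<in> L2 M" and f: "f \<in> borel_measurable M"
    and r: "filterlim r at_top sequentially"
    and lim: "AE x in M. (\<lambda>k. X (r k) x) \<longlonglongrightarrow> f x"
    and Cauchy: "\<And>e. 0 < e \<Longrightarrow> \<exists>N. \<forall>m\<ge>N. \<forall>n\<ge>N. L2_norm M (X m - X n) < e"
  shows "f \<in> L2 M" and "(\<lambda>n. L2_norm M (X n - f)) \<longlonglongrightarrow> 0"
proof -
  note [measurable] = f L2_measurable[OF X]
  have D: "X m - X n \<in> L2 M" for m n using cfun.subspace_diff[OF subspace_L2 X X] .
  have nn: "(\<integral>\<^sup>+x. ennreal ((cmod ((X m - X n) x))\<^sup>2) \<partial>M) = ennreal ((L2_norm M (X m - X n))\<^sup>2)" for m n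
    using L2_integrable[OF D] by (simp add: nn_integral_eq_integral L2_norm_def)
  have fatou: "(\<integral>\<^sup>+x. ennreal ((cmod (X n x - f x))\<^sup>2) \<partial>M) \<le> ennreal (e\<^sup>2)"
    if e: "e > 0" and N: "\<forall>m\<ge>N. \<forall>n\<ge>N. L2_norm M (X m - X n) < e" "n \<ge> N" for e N n
  proof -
    have "(\<integral>\<^sup>+x. ennreal ((cmod (X n x - f x))\<^sup>2) \<partial>M)
        = (\<integral>\<^sup>+x. liminf (\<lambda>k. ennreal ((cmod (X n x - X (r k) x))\<^sup>2)) \<partial>M)"
    proof (rule nn_integral_cong_AE, use lim in eventually_elim)
      fix x assume "(\<lambda>k. X (r k) x) \<longlonglongrightarrow> f x"
      then have "(\<lambda>k. ennreal ((cmod (X n x - X (r k) x))\<^sup>2)) \<longlonglongrightarrow> ennreal ((cmod (X n x - f x))\<^sup>2)"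
        by (intro tendsto_ennrealI tendsto_intros)
      then show "ennreal ((cmod (X n x - f x))\<^sup>2) = liminf (\<lambda>k. ennreal ((cmod (X n x - X (r k) x))\<^sup>2))"
        by (rule lim_imp_Liminf[OF sequentially_bot, symmetric])
    qed
    also have "\<dots> \<le> liminf (\<lambda>k. \<integral>\<^sup>+x. ennreal ((cmod (X n x - X (r k) x))\<^sup>2) \<partial>M)"
      by (rule nn_integral_liminf) measurable
    also have "\<dots> \<le> ennreal (e\<^sup>2)"
    proof (rule Liminf_le)
      have "\<forall>\<^sub>F k in sequentially. N \<le> r k" using r by (simp add: filterlim_at_top)
      then show "\<forall>\<^sub>F k in sequentially. (\<integral>\<^sup>+x. ennreal ((cmod (X n x - X (r k) x))\<^sup>2) \<partial>M) \<le> ennreal (e\<^sup>2)"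
      proof eventually_elim
        case (elim k)
        then have "L2_norm M (X n - X (r k)) < e" using N by blast
        then have "(L2_norm M (X n - X (r k)))\<^sup>2 \<le> e\<^sup>2"
          by (intro power_mono) (auto simp: L2_norm_def)
        then show ?case using nn[of n "r k"] by (simp add: fun_diff_def)
      qed
    qed simp
    finally show ?thesis .
  qed
  have int: "integrable M (\<lambda>x. (cmod (X n x - f x))\<^sup>2)"
    and le: "L2_norm M (X n - f) \<le> e"
    if e: "e > 0" and N: "\<forall>m\<ge>N. \<forall>n\<ge>N. L2_norm M (X m - X n) < e" "n \<ge> N" for e N n
  proof -
    show int: "integrable M (\<lambda>x. (cmod (X n x - f x))\<^sup>2)"
      using fatou[OF that] by (intro integrableI_nonneg) (auto simp: less_top intro: le_less_trans)
    have "ennreal ((L2_norm M (X n - f))\<^sup>2) \<le> ennreal (e\<^sup>2)"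
      using fatou[OF that] nn_integral_eq_integral[OF int] by (simp add: L2_norm_def fun_diff_def)
    then show "L2_norm M (X n - f) \<le> e" using e by (simp add: power2_le_iff_abs_le abs_le_iff)
  qed
  obtain N where N: "\<forall>m\<ge>N. \<forall>n\<ge>N. L2_norm M (X m - X n) < 1" using Cauchy[of 1] by auto
  have "X N - f \<in> L2 M"
    using int[OF _ N, of N] by (intro L2_I) (auto simp: fun_diff_def)
  then have "X N - (X N - f) \<in> L2 M" using cfun.subspace_diff[OF subspace_L2 X] by blast
  then show "f \<in> L2 M" by simp
  show "(\<lambda>n. L2_norm M (X n - f)) \<longlonglongrightarrow> 0"
  proof (rule LIMSEQ_I)
    fix e :: real assume e: "0 < e"
    obtain N where N: "\<forall>m\<ge>N. \<forall>n\<ge>N. L2_norm M (X m - X n) < e/2" using Cauchy[of "e/2"] e by auto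
    have "norm (L2_norm M (X n - f) - 0) < e" if "n \<ge> N" for n
      using le[OF _ N that] e by (simp add: L2_norm_def)
    then show "\<exists>N. \<forall>n\<ge>N. norm (L2_norm M (X n - f) - 0) < e" by blast
  qed
qed

lemma L2_complete:
  assumes X: "\<And>n. X n \<in> L2 M"
    and Cauchy: "\<And>e. 0 < e \<Longrightarrow> \<exists>N. \<forall>m\<ge>N. \<forall>n\<ge>N. L2_norm M (X m - X n) < e"
  shows "\<exists>f\<in>L2 M. (\<lambda>n. L2_norm M (X n - f)) \<longlonglongrightarrow> 0"
proof -
  note [measurable] = L2_measurable[OF X]
  have D: "X m - X n \<in> L2 M" for m n using cfun.subspace_diff[OF subspace_L2 X X] .
  have "\<exists>N. \<forall>m\<ge>N. \<forall>n\<ge>N. L2_norm M (X m - X n) < (1/2) ^ k" for k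
    using Cauchy by simp
  then obtain N where N: "\<And>k m n. m \<ge> N k \<Longrightarrow> n \<ge> N k \<Longrightarrow> L2_norm M (X m - X n) < (1/2) ^ k"
    by metis
  \<comment> \<open>The sum makes r monotone with r k at least N k; the summand k makes it
    unbounded.\<close>
  define r where "r k = k + (\<Sum>j\<le>k. N j)" for k
  have r: "r k \<ge> N k" "r (Suc k) \<ge> r k" "r k \<ge> k" for k
    using member_le_sum[of k "{..k}" N] by (auto simp: r_def)
  have r_top: "filterlim r at_top sequentially"
    using r(3) by (intro filterlim_at_top_mono[OF filterlim_ident]) auto
  define d where "d k x = cmod (X (r (Suc k)) x - X (r k) x)" for k x
  have [measurable]: "d k \<in> borel_measurable M" for k unfolding d_def by measurable
  \<comment> \<open>The weight 2^k leaves a summable bound, since 2^k (1/4)^k = (1/2)^k, and lets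
    the squares dominate \<open>d k x\<close> itself: by the arithmetic-geometric mean inequality it
    is at most (1/2)^k + 2^k d^2.\<close>
  have dn: "(\<integral>\<^sup>+x. ennreal (2 ^ k * (d k x)\<^sup>2) \<partial>M) \<le> ennreal ((1/2) ^ k)" for k
  proof -
    have "(\<integral>\<^sup>+x. ennreal (2 ^ k * (d k x)\<^sup>2) \<partial>M) = ennreal (2 ^ k * (L2_norm M (X (r (Suc k)) - X (r k)))\<^sup>2)"
      using L2_integrable[OF D[of "r (Suc k)" "r k"]]
      by (subst nn_integral_eq_integral) (auto simp: L2_norm_def d_def)
    also have "\<dots> \<le> ennreal (2 ^ k * ((1/2) ^ k)\<^sup>2)"
      using N[of k "r (Suc k)" "r k"] r[of k]
      by (intro ennreal_leI mult_left_mono power_mono) (auto simp: L2_norm_def)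
    also have "2 ^ k * ((1/2) ^ k)\<^sup>2 = (1/2 :: real) ^ k"
      by (simp add: power2_eq_square power_divide)
    finally show ?thesis .
  qed
  have "(\<integral>\<^sup>+x. (\<Sum>k. ennreal (2 ^ k * (d k x)\<^sup>2)) \<partial>M) = (\<Sum>k. \<integral>\<^sup>+x. ennreal (2 ^ k * (d k x)\<^sup>2) \<partial>M)"
    by (rule nn_integral_suminf) measurable
  also have "\<dots> \<le> (\<Sum>k. ennreal ((1/2) ^ k))"
    by (intro suminf_le dn) auto
  also have "\<dots> < \<infinity>"
    by (simp add: suminf_ennreal2 summable_geometric less_top[symmetric])
  finally have "AE x in M. (\<Sum>k. ennreal (2 ^ k * (d k x)\<^sup>2)) \<noteq> \<infinity>"
    by (intro nn_integral_PInf_AE) auto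
  then have conv: "AE x in M. convergent (\<lambda>k. X (r k) x)"
  proof eventually_elim
    case (elim x)
    then have "summable (\<lambda>k. 2 ^ k * (d k x)\<^sup>2)"
      by (intro summable_suminf_not_top) auto
    then have "summable (\<lambda>k. (1/2) ^ k + 2 ^ k * (d k x)\<^sup>2)"
      by (intro summable_add summable_geometric) auto
    moreover have "norm (X (r (Suc k)) x - X (r k) x) \<le> (1/2) ^ k + 2 ^ k * (d k x)\<^sup>2" for k
    proof -
      define a b where "a = sqrt ((1/2) ^ k)" and "b = sqrt (2 ^ k)"
      have "a * b = 1" "a\<^sup>2 = (1/2) ^ k" "b\<^sup>2 = 2 ^ k"
        by (simp_all add: a_def b_def power_divide del: real_sqrt_power flip: real_sqrt_mult)
      moreover have "2 * (a * b) * d k x \<le> a\<^sup>2 + b\<^sup>2 * (d k x)\<^sup>2"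
        using sum_squares_bound[of a "b * d k x"] by (simp add: power_mult_distrib mult.assoc)
      ultimately have "2 * d k x \<le> (1/2) ^ k + 2 ^ k * (d k x)\<^sup>2" by simp
      moreover have "0 \<le> d k x" by (simp add: d_def)
      ultimately have "d k x \<le> (1/2) ^ k + 2 ^ k * (d k x)\<^sup>2" by linarith
      then show ?thesis by (simp add: d_def)
    qed
    ultimately have "summable (\<lambda>k. X (r (Suc k)) x - X (r k) x)"
      by (rule summable_comparison_test'[where N = 0])
    then have "convergent (\<lambda>n. \<Sum>k<n. X (r (Suc k)) x - X (r k) x)"
      by (simp add: summable_iff_convergent)
    then have "convergent (\<lambda>n. X (r n) x - X (r 0) x)"
      by (simp add: sum_lessThan_telescope[of "\<lambda>k. X (r k) x"])
    then show ?case by (simp add: convergent_diff_const_right_iff)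
  qed
  define f where "f x = lim (\<lambda>k. X (r k) x)" for x
  have f: "f \<in> borel_measurable M" unfolding f_def by measurable
  have "AE x in M. (\<lambda>k. X (r k) x) \<longlonglongrightarrow> f x"
    using conv by (simp add: f_def convergent_LIMSEQ_iff)
  then show ?thesis
    using L2_norm_tendsto_of_AE[OF X f r_top _ Cauchy] by blast
qed

global_interpretation L2: semi_hilbert cfun_scale "L2 M" "L2_inner M" for M :: "'x measure"
proof
  fix f g h :: "'x \<Rightarrow> complex" and c
  show "cfun.subspace (L2 M)" by (rule subspace_L2)
  assume f: "f \<in> L2 M" and g: "g \<in> L2 M"
  show "L2_inner M (cfun_scale c f) g = c * L2_inner M f g"
    unfolding L2_inner_def cfun_scale_def by (simp add: mult.assoc)
  show "cnj (L2_inner M f g) = L2_inner M g f"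
    using Bochner_Integration.integral_cnj[of M "\<lambda>x. f x * cnj (g x)"] unfolding L2_inner_def by (simp add: mult.commute)
  assume h: "h \<in> L2 M"
  show "L2_inner M (f + g) h = L2_inner M f h + L2_inner M g h"
    using L2_mult_integrable[OF f h] L2_mult_integrable[OF g h]
    unfolding L2_inner_def by (simp add: distrib_right)
next
  fix f :: "'x \<Rightarrow> complex"
  show "0 \<le> Re (L2_inner M f f)" unfolding L2_inner_self by simp
next
  fix X :: "nat \<Rightarrow> 'x \<Rightarrow> complex"
  assume "\<And>n. X n \<in> L2 M"
    and "\<And>e. 0 < e \<Longrightarrow> \<exists>N. \<forall>m\<ge>N. \<forall>n\<ge>N. sqrt (Re (L2_inner M (X m - X n) (X m - X n))) < e"
  then show "\<exists>x\<in>L2 M. (\<lambda>n. sqrt (Re (L2_inner M (X n - x) (X n - x)))) \<longlonglongrightarrow> 0"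
    unfolding L2_norm_eq[symmetric] by (rule L2_complete)
qed

lemma L2_nrm: "L2.nrm M = L2_norm M"
  by (simp add: fun_eq_iff L2.nrm_def L2_norm_eq)

lemma L2_cl: "L2.cl M = L2_closure M"
  by (simp add: fun_eq_iff L2.cl_def L2_closure_def L2_nrm fun_diff_def)

lemma L2_closed_subspace_iff: "L2.closed_subspace M K \<longleftrightarrow> L2_closed_subspace M K"
  by (simp add: L2.closed_subspace_def L2_closed_subspace_def L2_cl)

lemma L2_inner_cong_AE:
  assumes "f \<in> borel_measurable M" "f' \<in> borel_measurable M" "g \<in> borel_measurable M"
    and "AE x in M. f x = f' x"
  shows "L2_inner M f g = L2_inner M f' g"
  unfolding L2_inner_def using assms by (intro integral_cong_AE) auto

lemma L2_restrict:
  assumes f: "f \<in> L2 M" and C: "C \<in> sets M"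
  shows "(\<lambda>x. indicator C x * f x) \<in> L2 M"
proof (rule L2_I)
  note [measurable] = L2_measurable[OF f] C
  show "(\<lambda>x. indicator C x * f x) \<in> borel_measurable M" by measurable
  show "integrable M (\<lambda>x. (cmod (indicator C x * f x))\<^sup>2)"
    by (rule Bochner_Integration.integrable_bound[OF L2_integrable[OF f]])
      (auto simp: indicator_def)
qed

lemma L2_norm_zero_AE:
  assumes f: "f \<in> L2 M"
  shows "L2_norm M f = 0 \<longleftrightarrow> (AE x in M. f x = 0)"
  using integral_nonneg_eq_0_iff_AE[OF L2_integrable[OF f]] by (simp add: L2_norm_def)

text \<open>The orthogonal complement of g is closed and contains D, hence contains g
  itself.\<close>

lemma L2_dense_orthogonal:
  assumes D: "D \<subseteq> L2 M" "L2_closure M D = L2 M" and g: "g \<in> L2 M"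
    and orth: "\<And>d. d \<in> D \<Longrightarrow> L2_inner M g d = 0"
  shows "L2_norm M g = 0"
proof -
  let ?K = "{h \<in> L2 M. \<forall>a\<in>{g}. L2_inner M h a = 0}"
  have "L2_inner M d g = 0" if "d \<in> D" for d
    using L2.ip_cnj[of g M d] orth[OF that] that D(1) g by auto
  then have "D \<subseteq> ?K" using D(1) by auto
  then have "L2.cl M D \<subseteq> L2.cl M ?K" by (rule L2.cl_mono)
  also have "\<dots> = ?K"
    using L2.closed_subspace_orthogonal[of "{g}" M] g by (simp add: L2.closed_subspace_def)
  finally have "L2_inner M g g = 0" using D(2) g by (auto simp: L2_cl)
  then show ?thesis by (simp add: L2_inner_self)
qed

section \<open>The unitary representation of a quasi-invariant action\<close>

locale sigma_finite_action = quasi_invariant_action M \<sigma> J + sigma_finite_measure M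
  for M :: "'x measure" and \<sigma> :: "'g::{countable, ab_group_add} \<Rightarrow> 'x \<Rightarrow> 'x" and J
begin

lemma action_space: "x \<in> space M \<Longrightarrow> \<sigma> \<gamma> x \<in> space M"
  using measurable_space[OF action_measurable] .

lemma action_cancel: "x \<in> space M \<Longrightarrow> \<sigma> (- \<gamma>) (\<sigma> \<gamma> x) = x" "x \<in> space M \<Longrightarrow> \<sigma> \<gamma> (\<sigma> (- \<gamma>) x) = x"
  by (simp_all add: action_add action_zero)

lemma action_image:
  assumes E: "E \<in> sets M"
  shows "\<sigma> \<gamma> ` E = \<sigma> (- \<gamma>) -` E \<inter> space M"
proof
  have "E \<subseteq> space M" using E by (rule sets.sets_into_space)
  then show "\<sigma> \<gamma> ` E \<subseteq> \<sigma> (- \<gamma>) -` E \<inter> space M"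
    using action_space by (force simp: action_cancel)
  show "\<sigma> (- \<gamma>) -` E \<inter> space M \<subseteq> \<sigma> \<gamma> ` E"
    by (auto simp: action_cancel intro!: image_eqI[where x = "\<sigma> (- \<gamma>) _"])
qed

lemma action_image_sets: "E \<in> sets M \<Longrightarrow> \<sigma> \<gamma> ` E \<in> sets M"
  by (simp add: action_image measurable_sets[OF action_measurable])

lemma jacobian_borel [measurable]: "J \<gamma> \<in> borel_measurable M"
proof -
  have "(\<lambda>x. (\<gamma>, x)) \<in> measurable M (count_space UNIV \<Otimes>\<^sub>M M)" by measurable
  from measurable_compose[OF this jacobian_measurable] show ?thesis by simp
qed

lemmas [measurable] = action_measurable

text \<open>Change of variables as an identity of measures: applied to the preimage of E, the
  Jacobian formula returns the measure of E. The integral formulas for the action are read off from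
  it.\<close>

lemma distr_action: "distr (density M (\<lambda>x. ennreal (J \<gamma> x))) M (\<sigma> \<gamma>) = M"
proof (rule measure_eqI)
  fix E assume "E \<in> sets (distr (density M (\<lambda>x. ennreal (J \<gamma> x))) M (\<sigma> \<gamma>))"
  then have E: "E \<in> sets M" by simp
  let ?E = "\<sigma> \<gamma> -` E \<inter> space M"
  have E': "?E = \<sigma> (- \<gamma>) ` E" using action_image[OF E, of "- \<gamma>"] by simp
  have "emeasure (distr (density M (\<lambda>x. ennreal (J \<gamma> x))) M (\<sigma> \<gamma>)) E = (\<integral>\<^sup>+x\<in>?E. ennreal (J \<gamma> x) \<partial>M)"
    using E by (simp add: emeasure_distr emeasure_density)
  also have "\<dots> = emeasure M (\<sigma> \<gamma> ` ?E)" using E by (simp add: jacobian)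
  also have "\<sigma> \<gamma> ` ?E = E"
    unfolding E' image_image using sets.sets_into_space[OF E] by (force simp: action_cancel)
  finally show "emeasure (distr (density M (\<lambda>x. ennreal (J \<gamma> x))) M (\<sigma> \<gamma>)) E = emeasure M E" .
qed simp

lemma nn_integral_action:
  assumes [measurable]: "h \<in> borel_measurable M"
  shows "(\<integral>\<^sup>+x. ennreal (J \<gamma> x) * h (\<sigma> \<gamma> x) \<partial>M) = (\<integral>\<^sup>+x. h x \<partial>M)"
proof -
  have "(\<integral>\<^sup>+x. h x \<partial>M) = (\<integral>\<^sup>+x. h x \<partial>distr (density M (\<lambda>x. ennreal (J \<gamma> x))) M (\<sigma> \<gamma>))"
    by (simp only: distr_action)
  also have "\<dots> = (\<integral>\<^sup>+x. ennreal (J \<gamma> x) * h (\<sigma> \<gamma> x) \<partial>M)"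
    by (subst nn_integral_distr) (simp_all add: nn_integral_density)
  finally show ?thesis ..
qed

lemma jacobian_nonneg: "x \<in> space M \<Longrightarrow> 0 \<le> J \<gamma> x"
  using jacobian_pos less_imp_le by blast

lemma
  fixes h :: "'x \<Rightarrow> 'b::{banach, second_countable_topology}"
  assumes [measurable]: "h \<in> borel_measurable M"
  shows integrable_action: "integrable M (\<lambda>x. J \<gamma> x *\<^sub>R h (\<sigma> \<gamma> x)) \<longleftrightarrow> integrable M h"
    and integral_action: "(LINT x|M. J \<gamma> x *\<^sub>R h (\<sigma> \<gamma> x)) = (LINT x|M. h x)"
proof -
  let ?D = "density M (\<lambda>x. ennreal (J \<gamma> x))"
  have J: "AE x in M. 0 \<le> J \<gamma> x" using jacobian_nonneg by auto
  have "integrable M h \<longleftrightarrow> integrable (distr ?D M (\<sigma> \<gamma>)) h" by (simp only: distr_action)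
  also have "\<dots> \<longleftrightarrow> integrable M (\<lambda>x. J \<gamma> x *\<^sub>R h (\<sigma> \<gamma> x))"
    using J by (simp add: integrable_distr_eq integrable_density)
  finally show "integrable M (\<lambda>x. J \<gamma> x *\<^sub>R h (\<sigma> \<gamma> x)) \<longleftrightarrow> integrable M h" ..
  have "(LINT x|M. h x) = (LINT x|distr ?D M (\<sigma> \<gamma>). h x)" by (simp only: distr_action)
  also have "\<dots> = (LINT x|M. J \<gamma> x *\<^sub>R h (\<sigma> \<gamma> x))"
    using J by (simp add: integral_distr integral_density)
  finally show "(LINT x|M. J \<gamma> x *\<^sub>R h (\<sigma> \<gamma> x)) = (LINT x|M. h x)" ..
qed

text \<open>Both sides are densities of the measure that sends E to the measure of its translate by
  \<open>\<gamma> + \<delta>\<close>; on a sigma-finite space densities are unique almost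
  everywhere.\<close>

lemma jacobian_cocycle: "AE x in M. J (\<gamma> + \<delta>) x = J \<gamma> (\<sigma> \<delta> x) * J \<delta> x"
proof -
  have "density M (\<lambda>x. ennreal (J (\<gamma> + \<delta>) x)) = density M (\<lambda>x. ennreal (J \<gamma> (\<sigma> \<delta> x) * J \<delta> x))"
  proof (rule measure_eqI)
    fix E assume "E \<in> sets (density M (\<lambda>x. ennreal (J (\<gamma> + \<delta>) x)))"
    then have E: "E \<in> sets M" by simp
    have E': "\<sigma> \<delta> ` E \<in> sets M" by (rule action_image_sets[OF E])
    note [measurable] = E E'
    have "emeasure (density M (\<lambda>x. ennreal (J (\<gamma> + \<delta>) x))) E = emeasure M (\<sigma> (\<gamma> + \<delta>) ` E)"
      using E by (simp add: emeasure_density jacobian)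
    also have "\<sigma> (\<gamma> + \<delta>) ` E = \<sigma> \<gamma> ` \<sigma> \<delta> ` E"
      using sets.sets_into_space[OF E] by (force simp: image_image action_add)
    also have "emeasure M (\<sigma> \<gamma> ` \<sigma> \<delta> ` E) = (\<integral>\<^sup>+x. ennreal (J \<gamma> x) * indicator (\<sigma> \<delta> ` E) x \<partial>M)"
      by (rule jacobian[OF E'])
    also have "\<dots> = (\<integral>\<^sup>+x. ennreal (J \<delta> x) * (ennreal (J \<gamma> (\<sigma> \<delta> x)) * indicator (\<sigma> \<delta> ` E) (\<sigma> \<delta> x)) \<partial>M)"
      by (rule nn_integral_action[symmetric]) measurable
    also have "\<dots> = (\<integral>\<^sup>+x. ennreal (J \<gamma> (\<sigma> \<delta> x) * J \<delta> x) * indicator E x \<partial>M)"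
    proof (rule nn_integral_cong)
      fix x assume x: "x \<in> space M"
      have "\<sigma> \<delta> x \<in> \<sigma> \<delta> ` E \<longleftrightarrow> x \<in> E"
        using x by (simp add: action_image[OF E] action_cancel action_space)
      then have "indicator (\<sigma> \<delta> ` E) (\<sigma> \<delta> x) = (indicator E x :: ennreal)" by (simp add: indicator_def)
      then show "ennreal (J \<delta> x) * (ennreal (J \<gamma> (\<sigma> \<delta> x)) * indicator (\<sigma> \<delta> ` E) (\<sigma> \<delta> x))
          = ennreal (J \<gamma> (\<sigma> \<delta> x) * J \<delta> x) * indicator E x"
        using x by (simp add: ennreal_mult jacobian_nonneg action_space mult_ac)
    qed
    also have "\<dots> = emeasure (density M (\<lambda>x. ennreal (J \<gamma> (\<sigma> \<delta> x) * J \<delta> x))) E"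
      using E by (subst emeasure_density) auto
    finally show "emeasure (density M (\<lambda>x. ennreal (J (\<gamma> + \<delta>) x))) E
        = emeasure (density M (\<lambda>x. ennreal (J \<gamma> (\<sigma> \<delta> x) * J \<delta> x))) E" .
  qed simp
  then have "AE x in M. ennreal (J (\<gamma> + \<delta>) x) = ennreal (J \<gamma> (\<sigma> \<delta> x) * J \<delta> x)"
    by (subst (asm) density_unique_iff) auto
  then show ?thesis
    using AE_space by eventually_elim (simp add: jacobian_nonneg action_space)
qed

text \<open>The cocycle relation at (0, 0) makes J 0 x idempotent, and positivity excludes the value
  0.\<close>

lemma jacobian_zero: "AE x in M. J 0 x = 1"
  using jacobian_cocycle[of 0 0] AE_space
proof eventually_elim
  case (elim x)
  then have "J 0 x * J 0 x = J 0 x" by (simp add: action_zero)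
  then show ?case using jacobian_pos[OF elim(2), of 0] by simp
qed

section \<open>The representation as an instance of the abstract setting\<close>

abbreviation "U \<equiv> action_rep \<sigma> J"

lemma rep_measurable:
  assumes [measurable]: "f \<in> borel_measurable M"
  shows "U \<gamma> f \<in> borel_measurable M"
  unfolding action_rep_def by measurable

lemma rep_mult:
  assumes "x \<in> space M"
  shows "U \<gamma> f x * cnj (U \<gamma> g x) = J (- \<gamma>) x *\<^sub>R (f (\<sigma> (- \<gamma>) x) * cnj (g (\<sigma> (- \<gamma>) x)))"
proof -
  have "complex_of_real (sqrt (J (- \<gamma>) x)) * complex_of_real (sqrt (J (- \<gamma>) x)) = complex_of_real (J (- \<gamma>) x)"
    using jacobian_nonneg[OF assms] by (simp flip: of_real_mult)
  then show ?thesis unfolding action_rep_def by (simp add: scaleR_conv_of_real mult_ac)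
qed

lemma rep_L2:
  assumes f: "f \<in> L2 M"
  shows "U \<gamma> f \<in> L2 M"
proof (rule L2_I)
  note [measurable] = L2_measurable[OF f]
  show "U \<gamma> f \<in> borel_measurable M" by (rule rep_measurable[OF L2_measurable[OF f]])
  have "integrable M (\<lambda>x. J (- \<gamma>) x *\<^sub>R (cmod (f (\<sigma> (- \<gamma>) x)))\<^sup>2)"
    using L2_integrable[OF f] by (subst integrable_action) auto
  then show "integrable M (\<lambda>x. (cmod (U \<gamma> f x))\<^sup>2)"
    by (rule Bochner_Integration.integrable_cong[THEN iffD1, rotated 2])
      (auto simp: action_rep_def norm_mult power_mult_distrib jacobian_nonneg)
qed

lemma rep_inner:
  assumes f: "f \<in> L2 M" and g: "g \<in> L2 M"
  shows "L2_inner M (U \<gamma> f) (U \<gamma> g) = L2_inner M f g"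
proof -
  note [measurable] = L2_measurable[OF f] L2_measurable[OF g]
  have "L2_inner M (U \<gamma> f) (U \<gamma> g)
      = (LINT x|M. J (- \<gamma>) x *\<^sub>R (f (\<sigma> (- \<gamma>) x) * cnj (g (\<sigma> (- \<gamma>) x))))"
    unfolding L2_inner_def by (intro Bochner_Integration.integral_cong rep_mult refl)
  also have "\<dots> = L2_inner M f g"
    unfolding L2_inner_def by (rule integral_action) measurable
  finally show ?thesis .
qed

lemma rep_rep: "AE x in M. U \<gamma> (U \<delta> f) x = U (\<gamma> + \<delta>) f x"
  \<comment> \<open>The left side evaluates f after \<open>\<sigma> (- \<gamma>)\<close> and then
    \<open>\<sigma> (- \<delta>)\<close>, which fixes the order of the arguments.\<close>
  using jacobian_cocycle[of "- \<delta>" "- \<gamma>"] AE_space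
proof eventually_elim
  case (elim x)
  then show ?case
    by (simp add: action_rep_def action_add real_sqrt_mult add.commute)
qed

lemma rep_zero: "AE x in M. U 0 f x = f x"
  using jacobian_zero AE_space by eventually_elim (simp add: action_rep_def action_zero)

sublocale rep: unitary_rep cfun_scale "L2 M" "L2_inner M" U
proof
  fix f g :: "'x \<Rightarrow> complex" and \<gamma> \<delta> c
  show "U \<gamma> (f + g) = U \<gamma> f + U \<gamma> g"
    by (simp add: action_rep_def fun_eq_iff distrib_left)
  show "U \<gamma> (cfun_scale c f) = cfun_scale c (U \<gamma> f)"
    by (simp add: action_rep_def cfun_scale_def fun_eq_iff)
  assume f: "f \<in> L2 M"
  show "U \<gamma> f \<in> L2 M" by (rule rep_L2[OF f])
  assume g: "g \<in> L2 M"
  show "L2_inner M (U \<gamma> f) (U \<gamma> g) = L2_inner M f g" by (rule rep_inner[OF f g])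
  show "L2_inner M (U \<gamma> (U \<delta> f)) g = L2_inner M (U (\<gamma> + \<delta>) f) g"
    using f g by (intro L2_inner_cong_AE rep_rep rep_measurable L2_measurable)
  show "L2_inner M (U 0 f) g = L2_inner M f g"
    using f g by (intro L2_inner_cong_AE rep_zero rep_measurable L2_measurable)
qed

lemma rep_cyclic: "rep.cyclic = cyclic_space M \<sigma> J"
  by (simp add: fun_eq_iff rep.cyclic_def cyclic_space_def L2_cl)

lemma rep_invariant: "rep.invariant V \<longleftrightarrow> invariant_space M \<sigma> J V"
  by (simp add: rep.invariant_def invariant_space_def L2_closed_subspace_iff)

text \<open>The translates of a function supported in a tile have almost disjoint supports.\<close>

lemma bessel_tile:
  assumes C: "C \<in> sets M" and disj: "\<And>\<gamma> \<delta>. \<gamma> \<noteq> \<delta> \<Longrightarrow> emeasure M (\<sigma> \<gamma> ` C \<inter> \<sigma> \<delta> ` C) = 0"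
    and f: "f \<in> L2 M" "\<And>x. x \<in> space M - C \<Longrightarrow> f x = 0" "L2_norm M f \<le> 1"
  shows "L2.bessel M (\<lambda>\<gamma>. U \<gamma> f)"
proof (rule L2.bessel_orthogonal)
  show "range (\<lambda>\<gamma>. U \<gamma> f) \<subseteq> L2 M" using f by (auto intro: rep_L2)
  show "L2.nrm M (U \<gamma> f) \<le> 1" for \<gamma>
    using f(3) rep.U_nrm[OF f(1), of \<gamma>] unfolding L2_nrm by simp
  fix \<gamma> \<delta> :: 'g assume "\<gamma> \<noteq> \<delta>"
  then have "\<sigma> \<gamma> ` C \<inter> \<sigma> \<delta> ` C \<in> null_sets M"
    using disj C by (intro null_setsI) (auto intro: action_image_sets)
  then have "AE x in M. x \<notin> \<sigma> \<gamma> ` C \<inter> \<sigma> \<delta> ` C" by (rule AE_not_in)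
  then have "AE x in M. U \<gamma> f x * cnj (U \<delta> f x) = 0"
    using AE_space
  proof eventually_elim
    case (elim x)
    then have "\<sigma> (- \<gamma>) x \<notin> C \<or> \<sigma> (- \<delta>) x \<notin> C" by (simp add: action_image[OF C])
    then show ?case using elim f(2) by (auto simp: action_rep_def action_space)
  qed
  then show "L2_inner M (U \<gamma> f) (U \<delta> f) = 0"
    unfolding L2_inner_def by (rule integral_eq_zero_AE)
qed

text \<open>Pulling h back by \<open>U (- \<gamma>)\<close> and restricting to C gives a vector
  orthogonal to the dense set D, hence null. So h vanishes on each tile, and countably many tiles
  cover almost everything.\<close>

lemma total_tile:
  assumes C: "C \<in> sets M" and cover: "emeasure M (space M - (\<Union>\<gamma>. \<sigma> \<gamma> ` C)) = 0"
    and D: "D \<subseteq> L2 M" "L2_closure M D = L2 M" and h: "h \<in> L2 M"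
    and orth: "\<And>d \<gamma>. d \<in> D \<Longrightarrow> L2_inner M h (U \<gamma> (\<lambda>x. indicator C x * d x)) = 0"
  shows "L2_norm M h = 0"
proof -
  note [measurable] = L2_measurable[OF h] C
  have tile: "AE x in M. x \<in> \<sigma> \<gamma> ` C \<longrightarrow> h x = 0" for \<gamma>
  proof -
    let ?g = "\<lambda>x. indicator C x * U (- \<gamma>) h x"
    have gL: "?g \<in> L2 M" by (intro L2_restrict rep_L2 h C)
    have "L2_inner M ?g d = 0" if d: "d \<in> D" for d
    proof -
      have dL: "d \<in> L2 M" using d D by blast
      have "L2_inner M ?g d = L2_inner M (U (- \<gamma>) h) (\<lambda>x. indicator C x * d x)"
        unfolding L2_inner_def by (intro Bochner_Integration.integral_cong) (auto simp: indicator_def)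
      also have "\<dots> = L2_inner M h (U \<gamma> (\<lambda>x. indicator C x * d x))"
        using rep.U_adjoint[OF h L2_restrict[OF dL C], of "- \<gamma>"] by simp
      finally show ?thesis using orth[OF d] by simp
    qed
    then have "L2_norm M ?g = 0" by (rule L2_dense_orthogonal[OF D gL])
    then have "AE x in M. ?g x = 0" using L2_norm_zero_AE[OF gL] by simp
    then have "AE x in M. x \<in> C \<longrightarrow> h (\<sigma> \<gamma> x) = 0"
      using AE_space
    proof eventually_elim
      case (elim x)
      then show ?case using jacobian_pos[of x \<gamma>] by (auto simp: action_rep_def)
    qed
    then have null: "emeasure M {x \<in> space M. \<not> (x \<in> C \<longrightarrow> h (\<sigma> \<gamma> x) = 0)} = 0"
      by (subst (asm) AE_iff_measurable[OF _ refl]) measurable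
    \<comment> \<open>The exceptional part of C. It is null, and the Jacobian formula shows that its
      translate is null too, which moves the statement from C to the translated tile.\<close>
    define E where "E = {x \<in> space M. \<not> (x \<in> C \<longrightarrow> h (\<sigma> \<gamma> x) = 0)}"
    have E: "E \<in> sets M" unfolding E_def by measurable
    have "E \<in> null_sets M" using null E by (auto simp: E_def)
    then have "AE x in M. x \<notin> E" by (rule AE_not_in)
    then have "(\<integral>\<^sup>+x\<in>E. ennreal (J \<gamma> x) \<partial>M) = (\<integral>\<^sup>+x. 0 \<partial>M)"
      by (intro nn_integral_cong_AE) (auto elim!: eventually_mono)
    then have "emeasure M (\<sigma> \<gamma> ` E) = 0" using jacobian[OF E, of \<gamma>] by simp
    then have "\<sigma> \<gamma> ` E \<in> null_sets M" using action_image_sets[OF E] by auto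
    then have "AE x in M. x \<notin> \<sigma> \<gamma> ` E" by (rule AE_not_in)
    then show ?thesis
      using AE_space
    proof eventually_elim
      case (elim x)
      then show ?case using sets.sets_into_space[OF C] by (auto simp: E_def)
    qed
  qed
  have "space M - (\<Union>\<gamma>. \<sigma> \<gamma> ` C) \<in> null_sets M"
    using cover C by (intro null_setsI) (auto intro!: sets.countable_UN'' action_image_sets sets.Diff)
  then have "AE x in M. x \<notin> space M - (\<Union>\<gamma>. \<sigma> \<gamma> ` C)" by (rule AE_not_in)
  moreover have "AE x in M. \<forall>\<gamma>. x \<in> \<sigma> \<gamma> ` C \<longrightarrow> h x = 0"
    using tile unfolding AE_all_countable by blast
  ultimately have "AE x in M. h x = 0"
    using AE_space by eventually_elim auto
  then show ?thesis using L2_norm_zero_AE[OF h] by simp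
qed

end

theorem theorem5p5:
  fixes M :: "'x measure"
    and \<sigma> :: "'g::{countable, ab_group_add} \<Rightarrow> 'x \<Rightarrow> 'x"
    and J :: "'g \<Rightarrow> 'x \<Rightarrow> real"
    and V :: "('x \<Rightarrow> complex) set"
  assumes "sigma_finite_measure M"
    and "L2_separable M"
    and "quasi_invariant_action M \<sigma> J"
    and "tiling_property M \<sigma>"
    and "invariant_space M \<sigma> J V"
  shows "\<exists>\<psi> :: nat \<Rightarrow> 'x \<Rightarrow> complex.
    (\<forall>n. \<psi> n \<in> L2 M) \<and>
    L2_orthogonal_sum M V (\<lambda>n. cyclic_space M \<sigma> J (\<psi> n)) \<and>
    (\<forall>n. L2_Parseval_frame M UNIV (\<lambda>\<gamma>. action_rep \<sigma> J \<gamma> (\<psi> n)) (cyclic_space M \<sigma> J (\<psi> n)))"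
proof -
  interpret sigma_finite_action M \<sigma> J
    using assms(1,3) by (simp add: sigma_finite_action_def)
  obtain C where C: "C \<in> sets M" "\<And>\<gamma> \<gamma>'. \<gamma> \<noteq> \<gamma>' \<Longrightarrow> emeasure M (\<sigma> \<gamma> ` C \<inter> \<sigma> \<gamma>' ` C) = 0"
    and cover: "emeasure M (space M - (\<Union>\<gamma>. \<sigma> \<gamma> ` C)) = 0"
    using assms(4) unfolding tiling_property_def by blast
  obtain D where D: "countable D" "D \<subseteq> L2 M" "L2_closure M D = L2 M"
    using assms(2) unfolding L2_separable_def by blast
  \<comment> \<open>Needed to enumerate D, possibly with repetitions, by
    \<open>from_nat_into\<close>.\<close>
  have "D \<noteq> {}"
  proof
    assume "D = {}"
    moreover have "L2_closure M {} = {}"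
      by (auto simp: L2_closure_def) (metis zero_less_one)
    ultimately have "L2 M = {}" using D(3) by simp
    then show False using cfun.subspace_0[OF subspace_L2] by blast
  qed
  define d where "d = from_nat_into D"
  have d: "d n \<in> D" "range d = D" for n
    using D(1) \<open>D \<noteq> {}\<close> by (auto simp: d_def from_nat_into range_from_nat_into)
  define \<phi>0 where "\<phi>0 n = (\<lambda>x. indicator C x * d n x)" for n
  \<comment> \<open>Dividing by the norm plus 1 gives norm at most 1 without dividing by zero when
    the restriction to C is null.\<close>
  define \<phi> where "\<phi> n = cfun_scale (of_real (1 / (L2_norm M (\<phi>0 n) + 1))) (\<phi>0 n)" for n
  have \<phi>0: "\<phi>0 n \<in> L2 M" for n unfolding \<phi>0_def using d(1) D(2) by (intro L2_restrict C) blast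
  have pos: "0 < L2_norm M (\<phi>0 n) + 1" for n by (simp add: L2_norm_def add_nonneg_pos)
  have \<phi>: "\<phi> n \<in> L2 M" for n unfolding \<phi>_def using \<phi>0 by (rule L2.H_scale)
  have bessel: "L2.bessel M (\<lambda>\<gamma>. U \<gamma> (\<phi> n))" for n
  proof (rule bessel_tile[OF C \<phi>])
    show "\<phi> n x = 0" if "x \<in> space M - C" for x
      using that by (simp add: \<phi>_def \<phi>0_def cfun_scale_def)
    show "L2_norm M (\<phi> n) \<le> 1"
      using L2.nrm_scale[OF \<phi>0] pos[of n] by (simp add: \<phi>_def L2_nrm norm_divide divide_le_eq_1 flip: of_real_add)
  qed
  have V: "rep.invariant V" using assms(5) by (simp add: rep_invariant)
  show ?thesis
  proof (rule rep.parseval_decomposition[OF V \<phi> bessel])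
    fix h assume h: "h \<in> L2 M" and orth: "\<And>n \<gamma>. L2_inner M h (U \<gamma> (\<phi> n)) = 0"
    show "L2.nrm M h = 0"
      unfolding L2_nrm
    proof (rule total_tile[OF C(1) cover D(2,3) h])
      fix e \<gamma> assume "e \<in> D"
      then obtain n where n: "e = d n" using d(2) by blast
      have "L2_inner M h (U \<gamma> (\<phi> n)) = of_real (1 / (L2_norm M (\<phi>0 n) + 1)) * L2_inner M h (U \<gamma> (\<phi>0 n))"
        unfolding \<phi>_def using h \<phi>0 by (simp add: rep.U_scale L2.ip_scale_right)
      then have "L2_inner M h (U \<gamma> (\<phi>0 n)) = 0"
        using orth[of \<gamma> n] pos[of n] by (auto simp flip: of_real_add)
      then show "L2_inner M h (U \<gamma> (\<lambda>x. indicator C x * e x)) = 0" by (simp add: n \<phi>0_def)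
    qed
  next
    fix \<psi> :: "nat \<Rightarrow> 'x \<Rightarrow> complex"
    assume \<psi>: "\<And>n. \<psi> n \<in> V" "\<And>n. rep.parseval_on (rep.cyclic (\<psi> n)) (\<psi> n)"
      and orth: "\<And>m n f g. m \<noteq> n \<Longrightarrow> f \<in> rep.cyclic (\<psi> m) \<Longrightarrow> g \<in> rep.cyclic (\<psi> n) \<Longrightarrow> L2_inner M f g = 0"
      and sum: "V = L2.cl M (cfun.span (\<Union>n. rep.cyclic (\<psi> n)))"
    have \<psi>L: "\<psi> n \<in> L2 M" for n
      using \<psi>(1) V by (auto simp: rep.invariant_def L2.closed_subspace_def)
    have "L2_orthogonal_sum M V (\<lambda>n. cyclic_space M \<sigma> J (\<psi> n))"
      unfolding L2_orthogonal_sum_def rep_cyclic[symmetric] L2_cl[symmetric]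
      using orth sum by simp
    moreover have "L2_Parseval_frame M UNIV (\<lambda>\<gamma>. U \<gamma> (\<psi> n)) (cyclic_space M \<sigma> J (\<psi> n))" for n
      using rep.orbit_in_cyclic[OF \<psi>L] \<psi>(2)[of n]
      unfolding L2_Parseval_frame_def rep.parseval_on_def rep_cyclic L2_nrm by simp
    ultimately show ?thesis using \<psi>L by blast
  qed
qed

end
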